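(* Let $\{\mathcal T_\alpha:\alpha\in\mathbb T^1\}$ be the one-parameter group of translation operators $(\mathcal T_\alpha(\xi,\chi))(\theta):=(\xi(\theta+\alpha),\chi(\theta+\alpha))$, $\theta\in\mathbb T^1$. Then: (i) the infinitesimal generator $\frac{d}{d\alpha}\big|_{\alpha=0}\mathcal T_\alpha$ of the group is the derivative operator $\partial_\theta$, which commutes with $\mathcal T_\alpha$: $\mathcal T_\alpha\circ\partial_\theta=\partial_\theta\circ\mathcal T_\alpha$; (ii) the Hamiltonian $\mathcal H$ is $\mathcal T_\alpha$-invariant and $\nabla\mathcal H$ is $\mathcal T_\alpha$-equivariant: $\mathcal H\circ\mathcal T_\alpha=\mathcal H$, $\nabla\mathcal H\circ\mathcal T_\alpha=\mathcal T_\alpha\circ\nabla\mathcal H$; (iii) the vector field $(-e^{2\xi}\chi',e^{2\xi}\xi')$ is the $L^2$-gradient of the angular momentum $$\mathcal I(\xi,\chi):=-\frac12\int_{\mathbb T^1}e^{2\xi}\chi'\,d\theta=\int_{\mathbb T^1}e^{2\xi}\xi'\chi\,d\theta,$$ which is a conserved quantity along the system $\partial_t\xi=e^{-2\xi}\partial_\chi\mathcal H(\xi,\chi)$, $\partial_t\chi=-e^{-2\xi}\partial_\xi\mathcal H(\xi,\chi)$, that is, $\{\mathcal I,\mathcal H\}=0$; moreover $\mathcal I$ is $\mathcal T_\alpha$-invariant and $\nabla\mathcal I$ is $\mathcal T_\alpha$-equivariant: $\mathcal I\circ\mathcal T_\alpha=\mathcal I$, $\nabla\mathcal I\circ\mathcal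 T_\alpha=\mathcal T_\alpha\circ\nabla\mathcal I$.
   Context: $\sigma_0$ is a constant; $\mathbb T^1=\mathbb R/2\pi\mathbb Z$; $\xi,\chi:\mathbb T^1\to\mathbb R$ are sufficiently smooth; a prime denotes $\partial_\theta$. $\partial_\xi A,\partial_\chi A$ are the $L^2(\mathbb T^1)$-gradients of a functional $A$, $\nabla A=(\partial_\xi A,\partial_\chi A)$, and $\{A,B\}(\xi,\chi)=\langle e^{-2\xi}\partial_\xi A,\partial_\chi B\rangle_{L^2}-\langle e^{-2\xi}\partial_\chi A,\partial_\xi B\rangle_{L^2}$. $$\mathcal H(\xi,\chi)=\frac12\int_{\mathbb T^1}\chi\,G(\xi)\chi\,d\theta+\sigma_0\int_{\mathbb T^1}e^{\xi}\sqrt{1+\xi'^2}\,d\theta-\frac{\sigma_0}2\int_{\mathbb T^1}e^{2\xi}\,d\theta,$$ where $G(\xi)\chi(\theta):=\partial_\rho\tilde\Phi(\xi(\theta),\theta)-\xi'(\theta)\partial_\theta\tilde\Phi(\xi(\theta),\theta)$ and $\tilde\Phi$ solves $\Delta\tilde\Phi=0$ in $\{(\rho,\theta)\in\mathbb R\times\mathbb T^1:\rho<\xi(\theta)\}$, $\tilde\Phi(\xi(\theta),\theta)=\chi(\theta)$, $\partial_\rho\tilde\Phi(\rho,\theta)\to0$ as $\rho\to-\infty$. *)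

theory Defs
  imports "HOL-Analysis.Analysis" "HOL-Library.Function_Algebras"
begin

text \<open>
  Functions on the circle are \<open>2\<pi>\<close>-periodic functions on the real line. States \<open>(\<xi>, \<psi>)\<close> are pairs
  of such functions; sums and differences of states are the pointwise ones. The second variable,
  chi in the source, is written \<open>\<psi>\<close>, since the Greek letter chi is a binder of the library.
\<close>

type_synonym state = "(real \<Rightarrow> real) \<times> (real \<Rightarrow> real)"

definition per :: "nat \<Rightarrow> (real \<Rightarrow> real) set" where
  "per k = {f. (\<forall>\<theta>. f (\<theta> + 2 * pi) = f \<theta>) \<and>
               (\<forall>j<k. \<forall>\<theta>. ((deriv ^^ j) f) field_differentiable (at \<theta>)) \<and>
               continuous_on UNIV ((deriv ^^ k) f)}"

definition states :: "nat \<Rightarrow> state set" where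
  "states k = per k \<times> per k"

definition per_norm :: "nat \<Rightarrow> (real \<Rightarrow> real) \<Rightarrow> real" where
  "per_norm k f = (\<Sum>j\<le>k. SUP \<theta>. \<bar>(deriv ^^ j) f \<theta>\<bar>)"

definition state_norm :: "nat \<Rightarrow> state \<Rightarrow> real" where
  "state_norm k u = per_norm k (fst u) + per_norm k (snd u)"

definition state_scale :: "real \<Rightarrow> state \<Rightarrow> state" where
  "state_scale c u = ((\<lambda>\<theta>. c * fst u \<theta>), (\<lambda>\<theta>. c * snd u \<theta>))"

definition L2 :: "(real \<Rightarrow> real) \<Rightarrow> (real \<Rightarrow> real) \<Rightarrow> real" where
  "L2 f g = integral {0..2 * pi} (\<lambda>\<theta>. f \<theta> * g \<theta>)"


section \<open>Translations\<close>

definition transl :: "real \<Rightarrow> state \<Rightarrow> state" where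
  "transl \<alpha> u = ((\<lambda>\<theta>. fst u (\<theta> + \<alpha>)), (\<lambda>\<theta>. snd u (\<theta> + \<alpha>)))"

definition d_theta :: "state \<Rightarrow> state" where
  "d_theta u = (deriv (fst u), deriv (snd u))"

text \<open>
  The generator of a family \<open>S\<close> on the space of \<open>C\<^sup>k\<close> states, as a graph: \<open>u\<close> is in its domain
  and is mapped to \<open>v\<close> iff the difference quotients of \<open>S \<alpha> u\<close> at \<open>\<alpha> = 0\<close> tend to \<open>v\<close> in \<open>C\<^sup>k\<close>.
\<close>

definition generates :: "nat \<Rightarrow> (real \<Rightarrow> state \<Rightarrow> state) \<Rightarrow> state \<Rightarrow> state \<Rightarrow> bool" where
  "generates k S u v \<longleftrightarrow> u \<in> states k \<and> v \<in> states k \<and>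
     ((\<lambda>\<alpha>. state_norm k (state_scale (1 / \<alpha>) (S \<alpha> u - u) - v)) \<longlongrightarrow> 0) (at 0)"


section \<open>L2-gradients and the Poisson bracket\<close>

text \<open>
  \<open>g\<close> is the gradient at \<open>u\<close> of a functional \<open>A\<close> on the space of \<open>C\<^sup>k\<close> states if \<open>A\<close> is
  Frechet differentiable at \<open>u\<close> for the \<open>C\<^sup>k\<close> norm and its differential is represented by the
  pair \<open>g\<close> of continuous periodic functions through the \<open>L\<^sup>2\<close> inner product. Such a \<open>g\<close> is unique.
\<close>

definition has_L2_gradient :: "nat \<Rightarrow> (state \<Rightarrow> real) \<Rightarrow> state \<Rightarrow> state \<Rightarrow> bool" where
  "has_L2_gradient k A u g \<longleftrightarrow> u \<in> states k \<and> g \<in> states 0 \<and>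
     (\<forall>\<epsilon>>0. \<exists>\<delta>>0. \<forall>h\<in>states k. state_norm k h < \<delta> \<longrightarrow>
        \<bar>A (u + h) - A u - (L2 (fst g) (fst h) + L2 (snd g) (snd h))\<bar> \<le> \<epsilon> * state_norm k h)"

definition L2_differentiable :: "nat \<Rightarrow> (state \<Rightarrow> real) \<Rightarrow> state \<Rightarrow> bool" where
  "L2_differentiable k A u \<longleftrightarrow> (\<exists>g. has_L2_gradient k A u g)"

definition L2_gradient :: "nat \<Rightarrow> (state \<Rightarrow> real) \<Rightarrow> state \<Rightarrow> state" where
  "L2_gradient k A u = (THE g. has_L2_gradient k A u g)"

abbreviation grad_xi :: "nat \<Rightarrow> (state \<Rightarrow> real) \<Rightarrow> state \<Rightarrow> real \<Rightarrow> real" where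
  "grad_xi k A u \<equiv> fst (L2_gradient k A u)"

abbreviation grad_chi :: "nat \<Rightarrow> (state \<Rightarrow> real) \<Rightarrow> state \<Rightarrow> real \<Rightarrow> real" where
  "grad_chi k A u \<equiv> snd (L2_gradient k A u)"

definition bracket :: "nat \<Rightarrow> (state \<Rightarrow> real) \<Rightarrow> (state \<Rightarrow> real) \<Rightarrow> state \<Rightarrow> real" where
  "bracket k A B u =
     L2 (\<lambda>\<theta>. exp (- 2 * fst u \<theta>) * grad_xi k A u \<theta>) (grad_chi k B u)
     - L2 (\<lambda>\<theta>. exp (- 2 * fst u \<theta>) * grad_chi k A u \<theta>) (grad_xi k B u)"

definition ham_field :: "nat \<Rightarrow> (state \<Rightarrow> real) \<Rightarrow> state \<Rightarrow> state" where
  "ham_field k A u =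
     ((\<lambda>\<theta>. exp (- 2 * fst u \<theta>) * grad_chi k A u \<theta>),
      (\<lambda>\<theta>. - exp (- 2 * fst u \<theta>) * grad_xi k A u \<theta>))"

text \<open>
  Solutions on a time interval \<open>J\<close>: curves of \<open>C\<^sup>k\<^sup>+\<^sup>1\<close> states, continuous in \<open>C\<^sup>k\<close>, whose time
  derivative exists in the sup norm. The weaker norm accounts for the loss of derivatives of the
  vector field.
\<close>

definition ham_solution :: "nat \<Rightarrow> (state \<Rightarrow> real) \<Rightarrow> real set \<Rightarrow> (real \<Rightarrow> state) \<Rightarrow> bool" where
  "ham_solution k A J u \<longleftrightarrow>
     (\<forall>t\<in>J. u t \<in> states (Suc k) \<and> L2_differentiable k A (u t) \<and>
        ((\<lambda>s. state_norm k (u s - u t)) \<longlongrightarrow> 0) (at t within J) \<and>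
        ((\<lambda>s. state_norm 0 (state_scale (1 / (s - t)) (u s - u t) - ham_field k A (u t))) \<longlongrightarrow> 0)
          (at t within J))"


section \<open>The Dirichlet-Neumann operator and the Hamiltonian\<close>

text \<open>Points of the plane are \<open>(\<rho>, \<theta>)\<close>.\<close>

definition d1 :: "(real \<times> real \<Rightarrow> real) \<Rightarrow> real \<times> real \<Rightarrow> real" where
  "d1 \<Phi> p = deriv (\<lambda>r. \<Phi> (r, snd p)) (fst p)"

definition d2 :: "(real \<times> real \<Rightarrow> real) \<Rightarrow> real \<times> real \<Rightarrow> real" where
  "d2 \<Phi> p = deriv (\<lambda>t. \<Phi> (fst p, t)) (snd p)"

definition C1_on :: "(real \<times> real) set \<Rightarrow> (real \<times> real \<Rightarrow> real) \<Rightarrow> bool" where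
  "C1_on D \<Phi> \<longleftrightarrow> \<Phi> differentiable_on D \<and> continuous_on D (d1 \<Phi>) \<and> continuous_on D (d2 \<Phi>)"

definition harmonic_on :: "(real \<times> real) set \<Rightarrow> (real \<times> real \<Rightarrow> real) \<Rightarrow> bool" where
  "harmonic_on D \<Phi> \<longleftrightarrow> C1_on D \<Phi> \<and> C1_on D (d1 \<Phi>) \<and> C1_on D (d2 \<Phi>) \<and>
     (\<forall>p\<in>D. d1 (d1 \<Phi>) p + d2 (d2 \<Phi>) p = 0)"

definition below :: "(real \<Rightarrow> real) \<Rightarrow> (real \<times> real) set" where
  "below \<xi> = {(\<rho>, \<theta>). \<rho> < \<xi> \<theta>}"

definition below_closed :: "(real \<Rightarrow> real) \<Rightarrow> (real \<times> real) set" where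
  "below_closed \<xi> = {(\<rho>, \<theta>). \<rho> \<le> \<xi> \<theta>}"

definition is_potential :: "(real \<Rightarrow> real) \<Rightarrow> (real \<Rightarrow> real) \<Rightarrow> (real \<times> real \<Rightarrow> real) \<Rightarrow> bool" where
  "is_potential \<xi> \<psi> \<Phi> \<longleftrightarrow>
     (\<forall>\<rho> \<theta>. \<Phi> (\<rho>, \<theta> + 2 * pi) = \<Phi> (\<rho>, \<theta>)) \<and>
     continuous_on (below_closed \<xi>) \<Phi> \<and>
     harmonic_on (below \<xi>) \<Phi> \<and>
     (\<forall>\<theta>. \<Phi> (\<xi> \<theta>, \<theta>) = \<psi> \<theta>) \<and>
     uniform_limit UNIV (\<lambda>\<rho> \<theta>. d1 \<Phi> (\<rho>, \<theta>)) (\<lambda>\<theta>. 0) at_bot"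

text \<open>
  \<open>P\<close> and \<open>Q\<close> are the continuous extensions of the partial derivatives of the potential to the
  closed domain; they give the meaning of these derivatives on the boundary curve.
\<close>

definition is_DN :: "(real \<Rightarrow> real) \<Rightarrow> (real \<Rightarrow> real) \<Rightarrow> (real \<Rightarrow> real) \<Rightarrow> bool" where
  "is_DN \<xi> \<psi> g \<longleftrightarrow>
     (\<exists>\<Phi> P Q. is_potential \<xi> \<psi> \<Phi> \<and>
        continuous_on (below_closed \<xi>) P \<and> continuous_on (below_closed \<xi>) Q \<and>
        (\<forall>p\<in>below \<xi>. P p = d1 \<Phi> p \<and> Q p = d2 \<Phi> p) \<and>
        (\<forall>\<theta>. g \<theta> = P (\<xi> \<theta>, \<theta>) - deriv \<xi> \<theta> * Q (\<xi> \<theta>, \<theta>)))"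

text \<open>
  For \<open>C\<^sup>2\<close> data the boundary value problem is uniquely solvable, and the solution is \<open>C\<^sup>1\<close> up to
  the boundary; the value \<open>0\<close> only makes the operator total on other arguments.
\<close>

definition DN :: "(real \<Rightarrow> real) \<Rightarrow> (real \<Rightarrow> real) \<Rightarrow> real \<Rightarrow> real" where
  "DN \<xi> \<psi> = (if \<exists>!g. is_DN \<xi> \<psi> g then (THE g. is_DN \<xi> \<psi> g) else (\<lambda>\<theta>. 0))"

definition hamiltonian :: "real \<Rightarrow> state \<Rightarrow> real" where
  "hamiltonian \<sigma>\<^sub>0 u = (case u of (\<xi>, \<psi>) \<Rightarrow>
     1 / 2 * integral {0..2 * pi} (\<lambda>\<theta>. \<psi> \<theta> * DN \<xi> \<psi> \<theta>)
     + \<sigma>\<^sub>0 * integral {0..2 * pi} (\<lambda>\<theta>. exp (\<xi> \<theta>) * sqrt (1 + (deriv \<xi> \<theta>)\<^sup>2))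
     - \<sigma>\<^sub>0 / 2 * integral {0..2 * pi} (\<lambda>\<theta>. exp (2 * \<xi> \<theta>)))"

definition ang_momentum :: "state \<Rightarrow> real" where
  "ang_momentum u = (case u of (\<xi>, \<psi>) \<Rightarrow>
     - (1 / 2) * integral {0..2 * pi} (\<lambda>\<theta>. exp (2 * \<xi> \<theta>) * deriv \<psi> \<theta>))"

end

theory Submission
  imports Defs
begin

text \<open>
  Invariance of \<open>\<H>\<close> holds because translating a solution of the boundary value problem gives a
  solution for the translated data, so the Dirichlet-Neumann operator commutes with translations.
  Differentiating \<open>\<H> \<circ> T\<^sub>\<alpha> = \<H>\<close> at \<open>\<alpha> = 0\<close> along \<open>C\<^sup>k\<^sup>+\<^sup>1\<close> states shows that \<open>\<nabla>\<H>\<close> is orthogonal to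
  \<open>\<partial>\<^sub>\<theta>\<close>, and with \<open>\<nabla>\<I> = (- e\<^bsup>2\<xi>\<^esup> \<psi>', e\<^bsup>2\<xi>\<^esup> \<xi>')\<close> the weights \<open>e\<^bsup>-2\<xi>\<^esup>\<close> of the bracket cancel, so that
  \<open>{\<I>, \<H>} = - \<langle>\<nabla>\<H>, \<partial>\<^sub>\<theta>\<rangle> = 0\<close>.
\<close>


section \<open>Periodic functions\<close>

text \<open>The derivatives involved live in different norms, and this shapes the estimates.
  Gradients are taken in the C^k norm, but the derivative in \<theta> of a state is C^k only if the
  state is C^(k+1); orthogonality to \<open>d_theta\<close> and the vanishing of the bracket are
  therefore statements about C^(k+1) states. A solution has its time derivative only in the sup
  norm, so conservation is not the chain rule for the C^k differential of the angular momentum. It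
  rests on a remainder estimate by the product of a C^1 norm and a sup norm. The differential of the
  Hamiltonian is never computed: its invariance and its differentiability at the given state are all
  that enters. The invariance has to hold at every state, also where \<open>DN\<close> takes its
  default value. Translation matches the candidates for the Dirichlet-Neumann value of the two
  problems one to one, so unique solvability and its failure are both preserved.\<close>

lemma per_0_iff: "f \<in> per 0 \<longleftrightarrow> (\<forall>\<theta>. f (\<theta> + 2 * pi) = f \<theta>) \<and> continuous_on UNIV f"
  by (simp add: per_def)

lemma per_periodic: "f \<in> per k \<Longrightarrow> f (\<theta> + 2 * pi) = f \<theta>"
  by (simp add: per_def)

text \<open>By \<open>DERIV_shift\<close> the predicates from which \<open>deriv\<close> chooses
  coincide, so the equation holds for every function. It can thus be applied to boundary data and
  potentials before anything is known about their regularity.\<close>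

lemma deriv_translate: "deriv (\<lambda>\<theta>. f (\<theta> + \<alpha>)) = (\<lambda>\<theta>. deriv f (\<theta> + \<alpha>))"
  for f :: "real \<Rightarrow> real"
  by (simp add: fun_eq_iff deriv_def DERIV_shift)

lemma deriv_pow_translate:
  "(deriv ^^ j) (\<lambda>\<theta>. f (\<theta> + \<alpha>)) = (\<lambda>\<theta>. (deriv ^^ j) f (\<theta> + \<alpha>))"
  for f :: "real \<Rightarrow> real"
  by (induction j) (simp_all add: deriv_translate)

text \<open>Turns \<open>per\<close> into a recursion on its order, which drives most inductions
  below; the derivative is split off next to \<open>f\<close>, hence
  \<open>funpow_Suc_right\<close>. The point to check is the periodicity of \<open>deriv f\<close>,
  an instance of \<open>deriv_translate\<close>.\<close>

lemma per_Suc_iff: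
  "f \<in> per (Suc k) \<longleftrightarrow>
     (\<forall>\<theta>. f (\<theta> + 2 * pi) = f \<theta>) \<and> (\<forall>\<theta>. f field_differentiable at \<theta>) \<and> deriv f \<in> per k"
proof -
  have "deriv f (\<theta> + 2 * pi) = deriv f \<theta>" if "\<forall>\<theta>. f (\<theta> + 2 * pi) = f \<theta>" for \<theta>
    using deriv_translate[of f "2 * pi"] that by (metis (no_types, lifting) ext)
  then show ?thesis
    by (auto simp: per_def less_Suc_eq_0_disj simp del: funpow.simps(2)
        simp: funpow_Suc_right)
qed

lemma per_SucD: "f \<in> per (Suc k) \<Longrightarrow> f \<in> per k"
proof (induction k arbitrary: f)
  case 0
  then show ?case
    by (auto simp: per_0_iff per_Suc_iff intro!: continuous_at_imp_continuous_on
        field_differentiable_imp_continuous_at)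
next
  case (Suc k)
  then show ?case
    by (metis per_Suc_iff)
qed

lemma per_antimono: "j \<le> k \<Longrightarrow> f \<in> per k \<Longrightarrow> f \<in> per j"
  by (induction k rule: dec_induct) (auto dest: per_SucD)

lemma per_deriv: "f \<in> per (Suc k) \<Longrightarrow> deriv f \<in> per k"
  by (simp add: per_Suc_iff)

lemma per_has_deriv:
  assumes "f \<in> per k" "k > 0"
  shows "(f has_real_derivative deriv f \<theta>) (at \<theta>)"
  using assms by (cases k) (auto simp: per_Suc_iff DERIV_deriv_iff_field_differentiable)

lemma per_deriv_pow: "f \<in> per (j + k) \<Longrightarrow> (deriv ^^ j) f \<in> per k"
  by (induction j arbitrary: k) (auto dest: per_deriv simp flip: add_Suc_right)

lemma per_deriv_pow_0: "f \<in> per k \<Longrightarrow> j \<le> k \<Longrightarrow> (deriv ^^ j) f \<in> per 0"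
  using per_deriv_pow[of f j 0] per_antimono by auto

lemma per_translate: "f \<in> per k \<Longrightarrow> (\<lambda>\<theta>. f (\<theta> + \<alpha>)) \<in> per k"
proof (induction k arbitrary: f)
  case 0
  have "continuous_on UNIV (\<lambda>\<theta>. f (\<theta> + \<alpha>))"
    by (rule continuous_on_compose2[of UNIV f])
      (use 0 in \<open>auto simp: per_0_iff intro!: continuous_intros\<close>)
  then show ?case
    using 0 by (auto simp: per_0_iff algebra_simps) (metis add.assoc)
next
  case (Suc k)
  have "(\<lambda>\<theta>. f (\<theta> + \<alpha>)) field_differentiable at \<theta>" for \<theta>
    using Suc.prems DERIV_shift unfolding per_Suc_iff field_differentiable_def by blast
  moreover have "f (\<theta> + 2 * pi + \<alpha>) = f (\<theta> + \<alpha>)" for \<theta>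
    using per_periodic[OF Suc.prems, of "\<theta> + \<alpha>"] by (simp add: algebra_simps)
  ultimately show ?case
    using Suc by (simp add: per_Suc_iff deriv_translate)
qed

lemma deriv_lincomb:
  assumes "f \<in> per (Suc k)" "g \<in> per (Suc k)"
  shows "deriv (\<lambda>\<theta>. a * f \<theta> + b * g \<theta>) = (\<lambda>\<theta>. a * deriv f \<theta> + b * deriv g \<theta>)"
proof
  fix \<theta>
  show "deriv (\<lambda>\<theta>. a * f \<theta> + b * g \<theta>) \<theta> = a * deriv f \<theta> + b * deriv g \<theta>"
    by (rule DERIV_imp_deriv)
      (auto intro!: derivative_eq_intros per_has_deriv[OF assms(1)] per_has_deriv[OF assms(2)])
qed

text \<open>Two free coefficients cover sums, differences and multiples at once, so the induction on
  the order is done a single time.\<close>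

lemma per_lincomb:
  "f \<in> per k \<Longrightarrow> g \<in> per k \<Longrightarrow> (\<lambda>\<theta>. a * f \<theta> + b * g \<theta>) \<in> per k"
proof (induction k arbitrary: f g)
  case 0
  then show ?case
    by (auto simp: per_0_iff intro!: continuous_intros)
next
  case (Suc k)
  have "(\<lambda>\<theta>. a * f \<theta> + b * g \<theta>) field_differentiable at \<theta>" for \<theta>
    using Suc.prems by (auto simp: per_Suc_iff intro!: derivative_intros)
  then show ?case
    using Suc.IH[of "deriv f" "deriv g"] Suc.prems deriv_lincomb[OF Suc.prems]
    by (auto simp: per_Suc_iff)
qed

lemma deriv_pow_lincomb:
  "f \<in> per k \<Longrightarrow> g \<in> per k \<Longrightarrow> j \<le> k \<Longrightarrow>
    (deriv ^^ j) (\<lambda>\<theta>. a * f \<theta> + b * g \<theta>) = (\<lambda>\<theta>. a * (deriv ^^ j) f \<theta> + b * (deriv ^^ j) g \<theta>)"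
proof (induction j arbitrary: k f g)
  case (Suc j)
  then obtain k' where k: "k = Suc k'" "j \<le> k'"
    by (cases k) auto
  show ?case
    using Suc.IH[of "deriv f" k' "deriv g"] Suc.prems k
    by (simp add: funpow_Suc_right deriv_lincomb per_deriv del: funpow.simps(2))
qed auto

lemma per_add: "f \<in> per k \<Longrightarrow> g \<in> per k \<Longrightarrow> (\<lambda>\<theta>. f \<theta> + g \<theta>) \<in> per k"
  using per_lincomb[of f k g 1 1] by simp

lemma per_diff: "f \<in> per k \<Longrightarrow> g \<in> per k \<Longrightarrow> (\<lambda>\<theta>. f \<theta> - g \<theta>) \<in> per k"
  using per_lincomb[of f k g 1 "-1"] by simp

lemma per_cmult: "f \<in> per k \<Longrightarrow> (\<lambda>\<theta>. c * f \<theta>) \<in> per k"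
  using per_lincomb[of f k f c 0] by simp

lemma per_const: "(\<lambda>\<theta>. c) \<in> per k"
  by (induction k arbitrary: c) (simp_all add: per_0_iff per_Suc_iff)

lemma per_0_mult: "f \<in> per 0 \<Longrightarrow> g \<in> per 0 \<Longrightarrow> (\<lambda>\<theta>. f \<theta> * g \<theta>) \<in> per 0"
  by (auto simp: per_0_iff intro!: continuous_intros)

lemma per_0_uminus: "f \<in> per 0 \<Longrightarrow> (\<lambda>\<theta>. - f \<theta>) \<in> per 0"
  by (auto simp: per_0_iff intro!: continuous_intros)

lemma per_0_exp: "f \<in> per 0 \<Longrightarrow> (\<lambda>\<theta>. exp (f \<theta>)) \<in> per 0"
  by (auto simp: per_0_iff intro!: continuous_intros)

lemma per_0_sqrt: "f \<in> per 0 \<Longrightarrow> (\<lambda>\<theta>. sqrt (f \<theta>)) \<in> per 0"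
  by (auto simp: per_0_iff intro!: continuous_intros)

lemma per_0_power: "f \<in> per 0 \<Longrightarrow> (\<lambda>\<theta>. f \<theta> ^ n) \<in> per 0"
  by (auto simp: per_0_iff intro!: continuous_intros)

lemmas per_0_intros =
  per_add per_diff per_cmult per_const per_0_mult per_0_uminus per_0_exp per_0_sqrt per_0_power

section \<open>Reduction to one period: boundedness and uniform continuity\<close>

lemma periodic_reduce:
  fixes x :: real
  obtains n :: int where "0 \<le> x - of_int n * (2 * pi)" "x - of_int n * (2 * pi) \<le> 2 * pi"
proof -
  define n where "n = \<lfloor>x / (2 * pi)\<rfloor>"
  have "of_int n \<le> x / (2 * pi)" "x / (2 * pi) \<le> of_int n + 1"
    by (auto simp: n_def)
  then have "of_int n * (2 * pi) \<le> x" "x \<le> (of_int n + 1) * (2 * pi)"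
    by (simp_all add: pos_le_divide_eq pos_divide_le_eq)
  then show thesis
    by (intro that[of n]) (auto simp: algebra_simps)
qed

lemma per_minus_of_int: "f \<in> per k \<Longrightarrow> f (x - of_int n * (2 * pi)) = f x"
proof -
  assume "f \<in> per k"
  then interpret periodic_fun_simple f "2 * pi"
    by unfold_locales (rule per_periodic)
  show ?thesis
    by (rule minus_of_int)
qed

lemma per_bounded:
  assumes "f \<in> per k"
  obtains B where "B \<ge> 0" "\<And>\<theta>. \<bar>f \<theta>\<bar> \<le> B"
proof -
  have "continuous_on {0..2 * pi} f"
    using per_antimono[OF _ assms, of 0] by (auto simp: per_0_iff intro: continuous_on_subset)
  then have "bounded (f ` {0..2 * pi})"
    by (intro compact_imp_bounded compact_continuous_image) auto
  then obtain B where B: "\<And>\<theta>. \<theta> \<in> {0..2 * pi} \<Longrightarrow> \<bar>f \<theta>\<bar> \<le> B"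
    unfolding bounded_iff by fastforce
  have bound: "\<bar>f \<theta>\<bar> \<le> B" for \<theta>
    using B per_minus_of_int[OF assms] periodic_reduce[of \<theta>]
    by (metis atLeastAtMost_iff)
  show thesis
    using bound[of 0] by (intro that[of B] bound) auto
qed

lemma per_0_uniformly_continuous:
  assumes "f \<in> per 0" "e > 0"
  obtains d where "d > 0" "\<And>x y. \<bar>y - x\<bar> < d \<Longrightarrow> \<bar>f y - f x\<bar> < e"
proof -
  \<comment> \<open>The margin 1 on both sides keeps y in the compact interval once x has been moved
    into a period; this is why the radius below is \<open>min d 1\<close>.\<close>
  have "uniformly_continuous_on {- 1..2 * pi + 1} f"
    using assms by (intro compact_uniformly_continuous)
      (auto simp: per_0_iff intro: continuous_on_subset)
  then obtain d where d: "d > 0" "\<And>x y. x \<in> {- 1..2 * pi + 1} \<Longrightarrow> y \<in> {- 1..2 * pi + 1} \<Longrightarrow>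
      \<bar>y - x\<bar> < d \<Longrightarrow> \<bar>f y - f x\<bar> < e"
    using \<open>e > 0\<close> unfolding uniformly_continuous_on_def dist_real_def by metis
  show thesis
  proof (rule that[of "min d 1"])
    fix x y :: real
    assume xy: "\<bar>y - x\<bar> < min d 1"
    obtain n :: int where "0 \<le> x - of_int n * (2 * pi)" "x - of_int n * (2 * pi) \<le> 2 * pi"
      by (rule periodic_reduce)
    with xy have "\<bar>f (y - of_int n * (2 * pi)) - f (x - of_int n * (2 * pi))\<bar> < e"
      by (intro d) auto
    then show "\<bar>f y - f x\<bar> < e"
      using per_minus_of_int[OF assms(1)] by simp
  qed (use d in auto)
qed

text \<open>Mean value inequality for z \<mapsto> f z - f' \<theta> z near \<theta>: its derivative
  f' z - f' \<theta> is small uniformly in \<theta>. Periodicity is asked of f' alone because f will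
  also be an antiderivative, which need not be periodic.\<close>

lemma uniform_difference_quotient:
  assumes "\<And>\<theta>. (f has_real_derivative f' \<theta>) (at \<theta>)" "f' \<in> per 0" "e > 0"
  shows "\<forall>\<^sub>F \<alpha> in at 0. \<forall>\<theta>. \<bar>(f (\<theta> + \<alpha>) - f \<theta>) / \<alpha> - f' \<theta>\<bar> \<le> e"
proof -
  obtain d where d: "d > 0" "\<And>x y. \<bar>y - x\<bar> < d \<Longrightarrow> \<bar>f' y - f' x\<bar> < e"
    using per_0_uniformly_continuous[OF assms(2,3)] by blast
  have "\<bar>(f (\<theta> + \<alpha>) - f \<theta>) / \<alpha> - f' \<theta>\<bar> \<le> e" if "\<alpha> \<noteq> 0" "\<bar>\<alpha>\<bar> < d" for \<alpha> \<theta>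
  proof -
    have "norm ((f (\<theta> + \<alpha>) - f' \<theta> * (\<theta> + \<alpha>)) - (f \<theta> - f' \<theta> * \<theta>)) \<le> e * norm ((\<theta> + \<alpha>) - \<theta>)"
    proof (rule field_differentiable_bound[of "cball \<theta> \<bar>\<alpha>\<bar>"])
      fix z
      assume "z \<in> cball \<theta> \<bar>\<alpha>\<bar>"
      then have "\<bar>z - \<theta>\<bar> < d"
        using that by (simp add: dist_real_def abs_minus_commute)
      from d(2)[OF this] show "norm (f' z - f' \<theta>) \<le> e"
        by simp
      show "((\<lambda>z. f z - f' \<theta> * z) has_real_derivative f' z - f' \<theta>) (at z within cball \<theta> \<bar>\<alpha>\<bar>)"
        by (auto intro!: derivative_eq_intros has_field_derivative_at_within[OF assms(1)])
    qed (auto simp: dist_real_def)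
    then have "\<bar>f (\<theta> + \<alpha>) - f \<theta> - \<alpha> * f' \<theta>\<bar> \<le> e * \<bar>\<alpha>\<bar>"
      by (simp add: algebra_simps)
    moreover have "(f (\<theta> + \<alpha>) - f \<theta>) / \<alpha> - f' \<theta> = (f (\<theta> + \<alpha>) - f \<theta> - \<alpha> * f' \<theta>) / \<alpha>"
      using that by (simp add: field_simps)
    ultimately show ?thesis
      using that by (simp add: abs_divide pos_divide_le_eq)
  qed
  then show ?thesis
    unfolding eventually_at using d(1) by (auto simp: dist_real_def)
qed


section \<open>Integrals over a period\<close>

lemma per_0_continuous_on: "f \<in> per 0 \<Longrightarrow> continuous_on A f"
  by (auto simp: per_0_iff intro: continuous_on_subset)

lemma per_0_integrable: "f \<in> per 0 \<Longrightarrow> f integrable_on {0..2 * pi}"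
  by (intro integrable_continuous_real per_0_continuous_on)

lemma integral_deriv_real:
  fixes F :: "real \<Rightarrow> real"
  assumes "a \<le> b" "\<And>x. (F has_real_derivative f x) (at x)"
  shows "integral {a..b} f = F b - F a"
  using assms by (intro integral_unique fundamental_theorem_of_calculus)
    (auto simp flip: has_real_derivative_iff_has_vector_derivative
      intro: has_field_derivative_at_within)

text \<open>The increment of F over a period is constant because its derivative f (x + 2 pi) - f x
  vanishes. Both the shift invariance of integrals and the periodicity of Steklov averages are read
  off from this.\<close>

lemma per_antiderivative:
  assumes "f \<in> per 0"
  obtains F where "\<And>x. (F has_real_derivative f x) (at x)"
    "\<And>x. F (x + 2 * pi) - F x = integral {0..2 * pi} f"
proof -
  have "\<exists>F. \<forall>x. - \<infinity> < ereal x \<longrightarrow> ereal x < \<infinity> \<longrightarrow> (F has_vector_derivative f x) (at x)"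
    using assms by (intro einterval_antiderivative) (auto simp: per_0_iff continuous_on_eq_continuous_at)
  then obtain F where F: "\<And>x. (F has_real_derivative f x) (at x)"
    by (auto simp: has_real_derivative_iff_has_vector_derivative)
  have "((\<lambda>x. F (x + 2 * pi) - F x) has_real_derivative 0) (at x)" for x
    using F[of x] F[of "x + 2 * pi"] per_periodic[OF assms]
    by (auto intro!: derivative_eq_intros simp: DERIV_shift)
  then have "F (x + 2 * pi) - F x = F (0 + 2 * pi) - F 0" for x
    using DERIV_isconst_all[of "\<lambda>x. F (x + 2 * pi) - F x" x 0] by blast
  then show thesis
    using F by (intro that[of F]) (auto simp: integral_deriv_real[of 0 "2 * pi" F])
qed

lemma integral_translate:
  assumes "f \<in> per 0"
  shows "integral {0..2 * pi} (\<lambda>\<theta>. f (\<theta> + \<alpha>)) = integral {0..2 * pi} f"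
proof -
  obtain F where F: "\<And>x. (F has_real_derivative f x) (at x)"
    "\<And>x. F (x + 2 * pi) - F x = integral {0..2 * pi} f"
    using per_antiderivative[OF assms] by blast
  have "integral {0..2 * pi} (\<lambda>\<theta>. f (\<theta> + \<alpha>)) = F (2 * pi + \<alpha>) - F (0 + \<alpha>)"
    using F(1) DERIV_shift by (intro integral_deriv_real) (simp, blast)
  then show ?thesis
    using F(2)[of \<alpha>] by (simp add: add.commute)
qed

lemma integral_exact:
  assumes "\<And>\<theta>. (f has_real_derivative f' \<theta>) (at \<theta>)" "\<And>\<theta>. f (\<theta> + 2 * pi) = f \<theta>"
  shows "integral {0..2 * pi} f' = 0"
  using integral_deriv_real[of 0 "2 * pi" f f'] assms(1) assms(2)[of 0] by simp

lemma integral_period_bound: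
  assumes "f \<in> per 0" "\<And>\<theta>. \<bar>f \<theta>\<bar> \<le> B"
  shows "\<bar>integral {0..2 * pi} f\<bar> \<le> 2 * pi * B"
  using integral_bound[of 0 "2 * pi" f B] assms by (simp add: per_0_continuous_on mult.commute)

lemma L2_translate:
  assumes "f \<in> per 0" "g \<in> per 0"
  shows "L2 (\<lambda>\<theta>. f (\<theta> + \<alpha>)) (\<lambda>\<theta>. g (\<theta> + \<alpha>)) = L2 f g"
  unfolding L2_def by (rule integral_translate[OF per_0_mult[OF assms]])

lemma L2_lincomb_right:
  assumes "f \<in> per 0" "g \<in> per 0" "h \<in> per 0"
  shows "L2 f (\<lambda>\<theta>. a * g \<theta> + b * h \<theta>) = a * L2 f g + b * L2 f h"
proof -
  have "L2 f (\<lambda>\<theta>. a * g \<theta> + b * h \<theta>) =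
      integral {0..2 * pi} (\<lambda>\<theta>. a * (f \<theta> * g \<theta>) + b * (f \<theta> * h \<theta>))"
    unfolding L2_def by (simp add: algebra_simps)
  also have "\<dots> = a * L2 f g + b * L2 f h"
    unfolding L2_def using assms
    by (subst integral_add) (auto intro!: per_0_integrable per_0_intros)
  finally show ?thesis .
qed

lemma L2_commute: "L2 f g = L2 g f"
  by (simp add: L2_def mult.commute)

lemma L2_bound:
  assumes "f \<in> per 0" "g \<in> per 0" "\<And>\<theta>. \<bar>f \<theta>\<bar> \<le> B" "\<And>\<theta>. \<bar>g \<theta>\<bar> \<le> C"
  shows "\<bar>L2 f g\<bar> \<le> 2 * pi * (B * C)"
  unfolding L2_def
proof (rule integral_period_bound[OF per_0_mult[OF assms(1,2)]])
  show "\<bar>f \<theta> * g \<theta>\<bar> \<le> B * C" for \<theta>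
    using assms(3)[of \<theta>] assms(4)[of \<theta>] by (auto simp: abs_mult intro!: mult_mono)
qed

section \<open>Fundamental lemma of the calculus of variations for C^k periodic test
  functions\<close>

lemma L2_self_eq_0:
  assumes "f \<in> per 0" "L2 f f = 0"
  shows "f \<theta> = 0"
proof -
  have "\<forall>x\<in>{0..2 * pi}. f x * f x = 0"
    using assms by (subst integral_eq_0_iff[symmetric])
      (auto simp: L2_def intro!: per_0_continuous_on per_0_intros)
  moreover obtain n :: int where "0 \<le> \<theta> - of_int n * (2 * pi)" "\<theta> - of_int n * (2 * pi) \<le> 2 * pi"
    by (rule periodic_reduce)
  ultimately show ?thesis
    using per_minus_of_int[OF assms(1), of \<theta> n] by auto
qed

text \<open>The common ending of the epsilon arguments below. If x were nonzero, e = 1 would force C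
  > 0, and then e = |x| / (2 C) would bound |x| by its half.\<close>

lemma abs_le_all_eps_imp_0:
  fixes x C :: real
  assumes "\<And>e. e > 0 \<Longrightarrow> \<bar>x\<bar> \<le> e * C"
  shows "x = 0"
proof (rule ccontr)
  assume "x \<noteq> 0"
  then have C: "C > 0"
    using assms[of 1] by auto
  with assms[of "\<bar>x\<bar> / (2 * C)"] \<open>x \<noteq> 0\<close> show False
    by simp
qed

text \<open>Steklov averages \<open>(F (\<theta> + \<epsilon>) - F \<theta>) / \<epsilon>\<close>, where \<open>F' = h\<close>, gain one derivative and
  converge uniformly to \<open>h\<close>; hence the test space may be enlarged down to the continuous functions.\<close>

lemma orthogonal_per_Suc_imp_per:
  assumes "g \<in> per 0" "\<And>h. h \<in> per (Suc k) \<Longrightarrow> L2 g h = 0" "h \<in> per k"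
  shows "L2 g h = 0"
proof -
  have h0: "h \<in> per 0"
    using per_antimono[OF _ assms(3)] by simp
  obtain F where F: "\<And>x. (F has_real_derivative h x) (at x)"
    "\<And>x. F (x + 2 * pi) - F x = integral {0..2 * pi} h"
    using per_antiderivative[OF h0] by blast
  obtain B where B: "B \<ge> 0" "\<And>\<theta>. \<bar>g \<theta>\<bar> \<le> B"
    using per_bounded[OF assms(1)] by blast
  show ?thesis
  proof (rule abs_le_all_eps_imp_0)
    fix e :: real
    assume e: "e > 0"
    have "\<forall>\<^sub>F \<epsilon> in at (0::real). \<epsilon> \<noteq> 0 \<and> (\<forall>\<theta>. \<bar>(F (\<theta> + \<epsilon>) - F \<theta>) / \<epsilon> - h \<theta>\<bar> \<le> e)"
      using uniform_difference_quotient[OF F(1) h0 e]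
      by (intro eventually_conj) (simp_all add: eventually_neq_at_within)
    then obtain \<epsilon> :: real where \<epsilon>: "\<epsilon> \<noteq> 0" "\<And>\<theta>. \<bar>(F (\<theta> + \<epsilon>) - F \<theta>) / \<epsilon> - h \<theta>\<bar> \<le> e"
      using eventually_happens trivial_limit_at by blast
    define H where "H = (\<lambda>\<theta>. (F (\<theta> + \<epsilon>) - F \<theta>) / \<epsilon>)"
    have deriv_H: "(H has_real_derivative (h (\<theta> + \<epsilon>) - h \<theta>) / \<epsilon>) (at \<theta>)" for \<theta>
      unfolding H_def using \<epsilon>(1) F(1)[of "\<theta> + \<epsilon>"] F(1)[of \<theta>]
      by (auto intro!: derivative_eq_intros simp: DERIV_shift)
    \<comment> \<open>F gains the same amount over every period, so the gain cancels in the
      difference even if h has nonzero mean.\<close>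
    have "H (\<theta> + 2 * pi) = H \<theta>" for \<theta>
      using F(2)[of "\<theta> + \<epsilon>"] F(2)[of \<theta>] by (simp add: H_def algebra_simps)
    moreover have "(\<lambda>\<theta>. (h (\<theta> + \<epsilon>) - h \<theta>) / \<epsilon>) \<in> per k"
      using per_cmult[OF per_diff[OF per_translate[OF assms(3)] assms(3)], of "1 / \<epsilon>" \<epsilon>] by simp
    moreover have "deriv H = (\<lambda>\<theta>. (h (\<theta> + \<epsilon>) - h \<theta>) / \<epsilon>)"
      using deriv_H DERIV_imp_deriv by blast
    ultimately have H: "H \<in> per (Suc k)"
      using deriv_H by (auto simp: per_Suc_iff field_differentiable_def)
    then have H0: "H \<in> per 0"
      using per_antimono by blast
    have "L2 g h = L2 g (\<lambda>\<theta>. 1 * h \<theta> + (- 1) * H \<theta>)"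
      using assms(2)[OF H] by (subst L2_lincomb_right) (auto intro: assms(1) h0 H0)
    also have "\<bar>\<dots>\<bar> \<le> 2 * pi * (B * e)"
    proof (intro L2_bound assms(1) per_lincomb h0 H0 B)
      show "\<bar>1 * h \<theta> + (- 1) * H \<theta>\<bar> \<le> e" for \<theta>
        using \<epsilon>(2)[of \<theta>] unfolding H_def by linarith
    qed
    finally show "\<bar>L2 g h\<bar> \<le> e * (2 * pi * B)"
      by (simp add: algebra_simps)
  qed
qed

text \<open>Descending one order at a time, the test space grows to all continuous periodic
  functions, where g itself may be tested.\<close>

lemma orthogonal_per_imp_0:
  assumes "g \<in> per 0" "\<And>h. h \<in> per k \<Longrightarrow> L2 g h = 0"
  shows "g \<theta> = 0"
proof -
  have "L2 g h = 0" if "h \<in> per 0" for h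
    using assms(2) that
    by (induction k arbitrary: h) (metis, metis orthogonal_per_Suc_imp_per[OF assms(1)])
  then show ?thesis
    using L2_self_eq_0 assms(1) by blast
qed


section \<open>Norms and states\<close>

text \<open>A real \<open>SUP\<close> bounds its terms only over a set known to be bounded above;
  this makes \<open>per_norm\<close> usable.\<close>

lemma per_deriv_pow_bdd_above:
  assumes "f \<in> per k" "j \<le> k"
  shows "bdd_above (range (\<lambda>\<theta>. \<bar>(deriv ^^ j) f \<theta>\<bar>))"
proof -
  obtain B where "\<And>\<theta>. \<bar>(deriv ^^ j) f \<theta>\<bar> \<le> B"
    using per_bounded[OF per_deriv_pow_0[OF assms]] by blast
  then show ?thesis
    by (auto simp: bdd_above_def)
qed

lemma per_deriv_pow_le_SUP:
  "f \<in> per k \<Longrightarrow> j \<le> k \<Longrightarrow> \<bar>(deriv ^^ j) f \<theta>\<bar> \<le> (SUP \<theta>. \<bar>(deriv ^^ j) f \<theta>\<bar>)"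
  by (rule cSUP_upper[OF UNIV_I per_deriv_pow_bdd_above])

lemma SUP_deriv_pow_nonneg:
  "f \<in> per k \<Longrightarrow> j \<le> k \<Longrightarrow> 0 \<le> (SUP \<theta>. \<bar>(deriv ^^ j) f \<theta>\<bar>)"
  by (rule order_trans[OF abs_ge_zero per_deriv_pow_le_SUP[of f k j 0]])

lemma per_norm_mono: "j \<le> k \<Longrightarrow> f \<in> per k \<Longrightarrow> per_norm j f \<le> per_norm k f"
  unfolding per_norm_def by (intro sum_mono2) (auto intro: SUP_deriv_pow_nonneg)

lemma per_norm_ge:
  assumes "f \<in> per k" "j \<le> k"
  shows "\<bar>(deriv ^^ j) f \<theta>\<bar> \<le> per_norm k f"
proof -
  have "(SUP \<theta>. \<bar>(deriv ^^ j) f \<theta>\<bar>) \<le> per_norm k f"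
    unfolding per_norm_def using assms by (intro member_le_sum) (auto intro: SUP_deriv_pow_nonneg)
  with per_deriv_pow_le_SUP[OF assms, of \<theta>] show ?thesis
    by linarith
qed

lemma per_norm_ge_abs: "f \<in> per k \<Longrightarrow> \<bar>f \<theta>\<bar> \<le> per_norm k f"
  using per_norm_ge[of f k 0] by simp

lemma per_norm_nonneg: "f \<in> per k \<Longrightarrow> 0 \<le> per_norm k f"
  using per_norm_ge_abs[of f k 0] by linarith

lemma per_norm_le:
  assumes "\<And>j \<theta>. j \<le> k \<Longrightarrow> \<bar>(deriv ^^ j) f \<theta>\<bar> \<le> B"
  shows "per_norm k f \<le> real (Suc k) * B"
  unfolding per_norm_def
  using sum_bounded_above[of "{..k}" "\<lambda>j. SUP \<theta>. \<bar>(deriv ^^ j) f \<theta>\<bar>" B] assms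
  by (auto intro!: cSUP_least)

lemma per_norm_translate: "per_norm k (\<lambda>\<theta>. f (\<theta> + \<alpha>)) = per_norm k f"
proof -
  have "range (\<lambda>\<theta>. \<bar>(deriv ^^ j) f (\<theta> + \<alpha>)\<bar>) = range (\<lambda>\<theta>. \<bar>(deriv ^^ j) f \<theta>\<bar>)" for j
    by (auto simp: image_iff) (metis diff_add_cancel)
  then show ?thesis
    by (simp add: per_norm_def deriv_pow_translate)
qed

lemma per_norm_lincomb:
  assumes "f \<in> per k" "g \<in> per k"
  shows "per_norm k (\<lambda>\<theta>. a * f \<theta> + b * g \<theta>) \<le> \<bar>a\<bar> * per_norm k f + \<bar>b\<bar> * per_norm k g"
proof -
  have "(SUP \<theta>. \<bar>(deriv ^^ j) (\<lambda>\<theta>. a * f \<theta> + b * g \<theta>) \<theta>\<bar>) \<le>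
      \<bar>a\<bar> * (SUP \<theta>. \<bar>(deriv ^^ j) f \<theta>\<bar>) + \<bar>b\<bar> * (SUP \<theta>. \<bar>(deriv ^^ j) g \<theta>\<bar>)" if j: "j \<le> k" for j
  proof (rule cSUP_least)
    fix \<theta>
    have "\<bar>a * (deriv ^^ j) f \<theta> + b * (deriv ^^ j) g \<theta>\<bar> \<le>
        \<bar>a\<bar> * \<bar>(deriv ^^ j) f \<theta>\<bar> + \<bar>b\<bar> * \<bar>(deriv ^^ j) g \<theta>\<bar>"
      by (metis abs_mult abs_triangle_ineq)
    also have "\<dots> \<le> \<bar>a\<bar> * (SUP \<theta>. \<bar>(deriv ^^ j) f \<theta>\<bar>) + \<bar>b\<bar> * (SUP \<theta>. \<bar>(deriv ^^ j) g \<theta>\<bar>)"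
      by (intro add_mono mult_left_mono per_deriv_pow_le_SUP[OF assms(1) j]
          per_deriv_pow_le_SUP[OF assms(2) j]) auto
    finally show "\<bar>(deriv ^^ j) (\<lambda>\<theta>. a * f \<theta> + b * g \<theta>) \<theta>\<bar> \<le> \<dots>"
      by (simp add: deriv_pow_lincomb[OF assms j])
  qed simp
  then show ?thesis
    unfolding per_norm_def sum_distrib_left sum.distrib[symmetric] by (intro sum_mono) auto
qed

section \<open>States as pairs: closure properties, norm and translations\<close>

lemma states_iff: "u \<in> states k \<longleftrightarrow> fst u \<in> per k \<and> snd u \<in> per k"
  by (simp add: states_def mem_Times_iff)

lemma states_antimono: "j \<le> k \<Longrightarrow> u \<in> states k \<Longrightarrow> u \<in> states j"
  using per_antimono by (auto simp: states_iff)

lemma states_add: "u \<in> states k \<Longrightarrow> v \<in> states k \<Longrightarrow> u + v \<in> states k"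
  by (simp add: states_iff plus_fun_def per_add)

lemma states_diff: "u \<in> states k \<Longrightarrow> v \<in> states k \<Longrightarrow> u - v \<in> states k"
  by (simp add: states_iff fun_diff_def per_diff)

lemma states_scale: "u \<in> states k \<Longrightarrow> state_scale c u \<in> states k"
  by (simp add: states_iff state_scale_def per_cmult)

lemma states_transl: "u \<in> states k \<Longrightarrow> transl \<alpha> u \<in> states k"
  by (simp add: states_iff transl_def per_translate)

lemma states_d_theta: "u \<in> states (Suc k) \<Longrightarrow> d_theta u \<in> states k"
  by (simp add: states_iff d_theta_def per_deriv)

lemma state_norm_ge:
  assumes "u \<in> states k" "j \<le> k"
  shows "\<bar>(deriv ^^ j) (fst u) \<theta>\<bar> \<le> state_norm k u" "\<bar>(deriv ^^ j) (snd u) \<theta>\<bar> \<le> state_norm k u"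
  using assms per_norm_ge[of "fst u" k j \<theta>] per_norm_ge[of "snd u" k j \<theta>]
    per_norm_nonneg[of "fst u" k] per_norm_nonneg[of "snd u" k]
  by (auto simp: state_norm_def states_iff)

lemma state_norm_ge_abs:
  assumes "u \<in> states k"
  shows "\<bar>fst u \<theta>\<bar> \<le> state_norm k u" "\<bar>snd u \<theta>\<bar> \<le> state_norm k u"
  using state_norm_ge[OF assms, of 0] by auto

lemma state_norm_nonneg: "u \<in> states k \<Longrightarrow> 0 \<le> state_norm k u"
  by (simp add: state_norm_def states_iff per_norm_nonneg)

lemma state_norm_mono: "j \<le> k \<Longrightarrow> u \<in> states k \<Longrightarrow> state_norm j u \<le> state_norm k u"
  by (simp add: state_norm_def states_iff add_mono per_norm_mono)

lemma state_norm_triangle: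
  assumes "u \<in> states k" "v \<in> states k"
  shows "state_norm k (u + v) \<le> state_norm k u + state_norm k v"
  using assms per_norm_lincomb[of "fst u" k "fst v" 1 1] per_norm_lincomb[of "snd u" k "snd v" 1 1]
  by (simp add: state_norm_def states_iff plus_fun_def)

lemma state_norm_scale_le:
  assumes "u \<in> states k"
  shows "state_norm k (state_scale c u) \<le> \<bar>c\<bar> * state_norm k u"
  using assms per_norm_lincomb[of "fst u" k "fst u" c 0] per_norm_lincomb[of "snd u" k "snd u" c 0]
  by (simp add: state_norm_def states_iff state_scale_def algebra_simps)

lemma state_norm_transl: "state_norm k (transl \<alpha> u) = state_norm k u"
  by (simp add: state_norm_def transl_def per_norm_translate)

lemma transl_add: "transl \<alpha> (u + v) = transl \<alpha> u + transl \<alpha> v"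
  by (simp add: transl_def prod_eq_iff fun_eq_iff)

lemma transl_0: "transl 0 u = u"
  by (simp add: transl_def)

lemma transl_transl: "transl \<alpha> (transl \<beta> u) = transl (\<alpha> + \<beta>) u"
  by (simp add: transl_def add.assoc)

lemma transl_period: "u \<in> states k \<Longrightarrow> transl (\<alpha> + 2 * pi) u = transl \<alpha> u"
  using per_periodic[of _ k] by (auto simp: transl_def states_iff simp flip: add.assoc)

lemma transl_d_theta: "transl \<alpha> (d_theta u) = d_theta (transl \<alpha> u)"
  by (simp add: transl_def d_theta_def deriv_translate)


section \<open>The generator of the translations\<close>

lemma deriv_pow_difference_quotient:
  assumes "f \<in> per k" "g \<in> per k" "j \<le> k"
  shows "(deriv ^^ j) (\<lambda>\<theta>. 1 / \<alpha> * (f (\<theta> + \<alpha>) - f \<theta>) - g \<theta>) =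
    (\<lambda>\<theta>. 1 / \<alpha> * ((deriv ^^ j) f (\<theta> + \<alpha>) - (deriv ^^ j) f \<theta>) - (deriv ^^ j) g \<theta>)"
proof -
  \<comment> \<open>The coefficients 1 and - 1 are written out to give nested linear combinations,
    to which \<open>deriv_pow_lincomb\<close> applies twice.\<close>
  have "(deriv ^^ j) (\<lambda>\<theta>. 1 * (1 / \<alpha> * f (\<theta> + \<alpha>) + - 1 / \<alpha> * f \<theta>) + - 1 * g \<theta>) =
      (\<lambda>\<theta>. 1 * (1 / \<alpha> * (deriv ^^ j) f (\<theta> + \<alpha>) + - 1 / \<alpha> * (deriv ^^ j) f \<theta>)
        + - 1 * (deriv ^^ j) g \<theta>)"
    using deriv_pow_lincomb[OF per_lincomb[OF per_translate[OF assms(1)] assms(1)] assms(2,3)]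
      deriv_pow_lincomb[OF per_translate[OF assms(1)] assms(1,3)]
    by (simp only: deriv_pow_translate)
  then show ?thesis
    by (simp add: right_diff_distrib)
qed

lemma per_norm_tendsto_0I:
  assumes "\<And>j e. j \<le> k \<Longrightarrow> e > 0 \<Longrightarrow> \<forall>\<^sub>F s in F. \<forall>\<theta>. \<bar>(deriv ^^ j) (f s) \<theta>\<bar> \<le> e"
    and "\<And>s. f s \<in> per k"
  shows "((\<lambda>s. per_norm k (f s)) \<longlongrightarrow> 0) F"
proof (rule tendstoI)
  fix e :: real
  assume "e > 0"
  \<comment> \<open>The k + 1 suprema then add up to at most e / 2; the factor 2 provides the strict
    inequality of the limit.\<close>
  then have "\<forall>\<^sub>F s in F. \<forall>j\<in>{..k}. \<forall>\<theta>. \<bar>(deriv ^^ j) (f s) \<theta>\<bar> \<le> e / (2 * real (Suc k))"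
    by (intro eventually_ball_finite ballI assms) auto
  then show "\<forall>\<^sub>F s in F. dist (per_norm k (f s)) 0 < e"
  proof eventually_elim
    case (elim s)
    then have "per_norm k (f s) \<le> real (Suc k) * (e / (2 * real (Suc k)))"
      by (intro per_norm_le) auto
    also have "\<dots> = e / 2"
      by (simp del: of_nat_Suc)
    finally show ?case
      using \<open>e > 0\<close> per_norm_nonneg[OF assms(2)[of s]] by (simp add: dist_real_def)
  qed
qed

text \<open>The j-th derivative of the difference quotient is the difference quotient of the j-th
  derivative, which is still C^1 since j \<le> k; so each order converges uniformly.\<close>

lemma per_difference_quotient_tendsto:
  assumes "f \<in> per (Suc k)"
  shows "((\<lambda>\<alpha>. per_norm k (\<lambda>\<theta>. 1 / \<alpha> * (f (\<theta> + \<alpha>) - f \<theta>) - deriv f \<theta>)) \<longlongrightarrow> 0) (at 0)"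
proof (rule per_norm_tendsto_0I)
  have f: "f \<in> per k" "deriv f \<in> per k"
    using assms by (auto dest: per_SucD per_deriv)
  show "(\<lambda>\<theta>. 1 / \<alpha> * (f (\<theta> + \<alpha>) - f \<theta>) - deriv f \<theta>) \<in> per k" for \<alpha>
    by (intro per_diff per_cmult per_translate f)
  fix j and e :: real
  assume j: "j \<le> k" and e: "e > 0"
  have "(deriv ^^ j) f \<in> per (Suc 0)"
    using per_deriv_pow[of f j "Suc 0"] per_antimono[OF _ assms, of "j + 1"] j by simp
  then have "\<forall>\<^sub>F \<alpha> in at 0. \<forall>\<theta>. \<bar>((deriv ^^ j) f (\<theta> + \<alpha>) - (deriv ^^ j) f \<theta>) / \<alpha>
      - deriv ((deriv ^^ j) f) \<theta>\<bar> \<le> e"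
    using e by (intro uniform_difference_quotient per_has_deriv per_deriv) auto
  then show "\<forall>\<^sub>F \<alpha> in at 0. \<forall>\<theta>.
      \<bar>(deriv ^^ j) (\<lambda>\<theta>. 1 / \<alpha> * (f (\<theta> + \<alpha>) - f \<theta>) - deriv f \<theta>) \<theta>\<bar> \<le> e"
    unfolding deriv_pow_difference_quotient[OF f j] by (simp add: funpow_swap1)
qed

text \<open>Pointwise convergence, which the norm controls, already identifies g as the derivative
  of f; that g is C^k then makes f of class C^(k+1). This gives the exact domain of the
  generator.\<close>

lemma per_difference_quotient_tendsto_imp:
  assumes "f \<in> per k" "g \<in> per k"
    and "((\<lambda>\<alpha>. per_norm k (\<lambda>\<theta>. 1 / \<alpha> * (f (\<theta> + \<alpha>) - f \<theta>) - g \<theta>)) \<longlongrightarrow> 0) (at 0)"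
  shows "f \<in> per (Suc k)" "deriv f = g"
proof -
  have D: "(f has_real_derivative g \<theta>) (at \<theta>)" for \<theta>
  proof -
    have "\<bar>(f (\<theta> + \<alpha>) - f \<theta>) / \<alpha> - g \<theta>\<bar> \<le> per_norm k (\<lambda>\<theta>. 1 / \<alpha> * (f (\<theta> + \<alpha>) - f \<theta>) - g \<theta>)" for \<alpha>
      using per_norm_ge_abs[OF per_diff[OF per_cmult[OF per_diff[OF per_translate[OF assms(1)]
        assms(1)]] assms(2)], of "1 / \<alpha>" \<theta> \<alpha>] by simp
    then have "((\<lambda>\<alpha>. (f (\<theta> + \<alpha>) - f \<theta>) / \<alpha> - g \<theta>) \<longlongrightarrow> 0) (at 0)"
      by (intro Lim_null_comparison[OF _ assms(3)] always_eventually) simp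
    then show ?thesis
      by (simp add: DERIV_def LIM_zero_iff)
  qed
  then show "deriv f = g"
    using DERIV_imp_deriv by blast
  with D show "f \<in> per (Suc k)"
    using assms(1,2) by (auto simp: per_Suc_iff field_differentiable_def per_periodic)
qed

lemma generates_transl_iff:
  "generates k transl u v \<longleftrightarrow> u \<in> states (Suc k) \<and> v = d_theta u"
proof -
  let ?q = "\<lambda>\<alpha> f g. \<lambda>\<theta>::real. 1 / \<alpha> * (f (\<theta> + \<alpha>) - f \<theta>) - g \<theta> :: real"
  have norm_eq: "state_norm k (state_scale (1 / \<alpha>) (transl \<alpha> u - u) - v) =
      per_norm k (?q \<alpha> (fst u) (fst v)) + per_norm k (?q \<alpha> (snd u) (snd v))" for \<alpha> v
    by (simp add: state_norm_def state_scale_def transl_def fun_diff_def)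
  show ?thesis
  proof
    assume gen: "generates k transl u v"
    then have uv: "fst u \<in> per k" "snd u \<in> per k" "fst v \<in> per k" "snd v \<in> per k"
      by (auto simp: generates_def states_iff)
    have q: "?q \<alpha> (fst u) (fst v) \<in> per k" "?q \<alpha> (snd u) (snd v) \<in> per k" for \<alpha>
      by (intro per_diff per_cmult per_translate uv)+
    have lim: "((\<lambda>\<alpha>. per_norm k (?q \<alpha> (fst u) (fst v)) + per_norm k (?q \<alpha> (snd u) (snd v))) \<longlongrightarrow> 0) (at 0)"
      using gen by (simp add: generates_def norm_eq)
    have "((\<lambda>\<alpha>. per_norm k (?q \<alpha> (fst u) (fst v))) \<longlongrightarrow> 0) (at 0)"
      "((\<lambda>\<alpha>. per_norm k (?q \<alpha> (snd u) (snd v))) \<longlongrightarrow> 0) (at 0)"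
      using per_norm_nonneg[OF q(1)] per_norm_nonneg[OF q(2)]
      by (intro Lim_null_comparison[OF always_eventually lim]; force)+
    from per_difference_quotient_tendsto_imp[OF uv(1,3) this(1)]
      per_difference_quotient_tendsto_imp[OF uv(2,4) this(2)]
    show "u \<in> states (Suc k) \<and> v = d_theta u"
      by (simp add: states_iff d_theta_def prod_eq_iff)
  next
    assume u: "u \<in> states (Suc k) \<and> v = d_theta u"
    then have "((\<lambda>\<alpha>. per_norm k (?q \<alpha> (fst u) (fst v)) + per_norm k (?q \<alpha> (snd u) (snd v)))
        \<longlongrightarrow> 0 + 0) (at 0)"
      unfolding d_theta_def states_iff
      by (intro tendsto_add) (use per_difference_quotient_tendsto in force)+
    with u show "generates k transl u v"
      using states_antimono[of k "Suc k" u] states_d_theta[of u k]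
      by (simp add: generates_def norm_eq)
  qed
qed


section \<open>Gradients\<close>

text \<open>The pairing that \<open>has_L2_gradient\<close> writes out, named so that linearity,
  bounds and translation invariance can be stated for states.\<close>

definition state_L2 :: "state \<Rightarrow> state \<Rightarrow> real" where
  "state_L2 g h = L2 (fst g) (fst h) + L2 (snd g) (snd h)"

lemma state_L2_add_right:
  assumes "g \<in> states 0" "h \<in> states 0" "h' \<in> states 0"
  shows "state_L2 g (h + h') = state_L2 g h + state_L2 g h'"
  using assms L2_lincomb_right[of "fst g" "fst h" "fst h'" 1 1]
    L2_lincomb_right[of "snd g" "snd h" "snd h'" 1 1]
  by (simp add: state_L2_def states_iff plus_fun_def)

lemma state_L2_scale_right:
  assumes "g \<in> states 0" "h \<in> states 0"
  shows "state_L2 g (state_scale c h) = c * state_L2 g h"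
  using assms L2_lincomb_right[of "fst g" "fst h" "fst h" c 0]
    L2_lincomb_right[of "snd g" "snd h" "snd h" c 0]
  by (simp add: state_L2_def states_iff state_scale_def algebra_simps)

lemma state_L2_transl:
  "g \<in> states 0 \<Longrightarrow> h \<in> states 0 \<Longrightarrow> state_L2 (transl \<alpha> g) (transl \<alpha> h) = state_L2 g h"
  by (simp add: state_L2_def transl_def states_iff L2_translate)

text \<open>The values of h are dominated by each of its C^k norms. It serves with the order k for
  difference quotients of translations and with order 0 for those of solutions in time.\<close>

lemma state_L2_bound:
  assumes "g \<in> states 0"
  obtains C where "C \<ge> 0" "\<And>h. h \<in> states k \<Longrightarrow> \<bar>state_L2 g h\<bar> \<le> C * state_norm k h"
proof -
  obtain B where B: "B \<ge> 0" "\<And>\<theta>. \<bar>fst g \<theta>\<bar> \<le> B"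
    using per_bounded assms by (metis states_iff)
  obtain B' where B': "B' \<ge> 0" "\<And>\<theta>. \<bar>snd g \<theta>\<bar> \<le> B'"
    using per_bounded assms by (metis states_iff)
  show thesis
  proof (rule that)
    show "2 * pi * (B + B') \<ge> 0"
      using B B' by simp
    fix h
    assume h: "h \<in> states k"
    then have "h \<in> states 0"
      using states_antimono by blast
    with h assms B B' have "\<bar>L2 (fst g) (fst h)\<bar> \<le> 2 * pi * (B * state_norm k h)"
      "\<bar>L2 (snd g) (snd h)\<bar> \<le> 2 * pi * (B' * state_norm k h)"
      by (auto simp: states_iff[of _ 0] intro!: L2_bound state_norm_ge_abs)
    then show "\<bar>state_L2 g h\<bar> \<le> 2 * pi * (B + B') * state_norm k h"
      unfolding state_L2_def by (simp add: algebra_simps)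
  qed
qed

section \<open>Uniqueness, equivariance and orthogonality of gradients\<close>

lemma has_L2_gradientD:
  assumes "has_L2_gradient k A u g"
  shows "u \<in> states k" "g \<in> states 0"
    "\<And>e. e > 0 \<Longrightarrow> \<exists>\<delta>>0. \<forall>h\<in>states k. state_norm k h < \<delta> \<longrightarrow>
        \<bar>A (u + h) - A u - state_L2 g h\<bar> \<le> e * state_norm k h"
  using assms by (auto simp: has_L2_gradient_def state_L2_def)

text \<open>On small multiples of a fixed direction both expansions apply, and homogeneity of the
  pairing shows that the two differentials agree on C^k states; \<open>orthogonal_per_imp_0\<close>
  then compares the representatives.\<close>

lemma has_L2_gradient_unique:
  assumes "has_L2_gradient k A u g" "has_L2_gradient k A u g'"
  shows "g = g'"
proof -
  have g: "g \<in> states 0" "g' \<in> states 0"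
    using assms by (auto dest: has_L2_gradientD)
  have eq: "state_L2 g h = state_L2 g' h" if h: "h \<in> states k" for h
  proof -
    have h0: "h \<in> states 0"
      using states_antimono h by blast
    have "state_L2 g h - state_L2 g' h = 0"
    proof (rule abs_le_all_eps_imp_0)
      fix e :: real
      assume e: "e > 0"
      obtain \<delta> where \<delta>: "\<delta> > 0" "\<And>h. h \<in> states k \<Longrightarrow> state_norm k h < \<delta> \<Longrightarrow>
          \<bar>A (u + h) - A u - state_L2 g h\<bar> \<le> e * state_norm k h"
        using has_L2_gradientD(3)[OF assms(1) e] by blast
      obtain \<delta>' where \<delta>': "\<delta>' > 0" "\<And>h. h \<in> states k \<Longrightarrow> state_norm k h < \<delta>' \<Longrightarrow>
          \<bar>A (u + h) - A u - state_L2 g' h\<bar> \<le> e * state_norm k h"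
        using has_L2_gradientD(3)[OF assms(2) e] by blast
      \<comment> \<open>N is positive even for h = 0, and c N is half the smaller radius, so the
        multiple c h lies in both balls.\<close>
      define N where "N = state_norm k h + 1"
      define c where "c = min \<delta> \<delta>' / (2 * N)"
      have N: "N > 0" "state_norm k h \<le> N"
        using state_norm_nonneg[OF h] by (auto simp: N_def)
      have c: "c > 0"
        using \<delta> \<delta>' N by (simp add: c_def)
      have "state_norm k (state_scale c h) \<le> c * N"
        using state_norm_scale_le[OF h, of c] c N
        by (auto intro: order_trans mult_left_mono)
      moreover from this have "state_norm k (state_scale c h) < min \<delta> \<delta>'"
        using \<delta> \<delta>' N by (simp add: c_def)
      ultimately have "\<bar>state_L2 g (state_scale c h) - state_L2 g' (state_scale c h)\<bar> \<le> e * (c * N) + e * (c * N)"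
        using \<delta>(2)[OF states_scale[OF h], of c] \<delta>'(2)[OF states_scale[OF h], of c] e
          mult_left_mono[of "state_norm k (state_scale c h)" "c * N" e]
        by linarith
      then have "c * \<bar>state_L2 g h - state_L2 g' h\<bar> \<le> c * (e * (2 * N))"
        using c by (simp add: state_L2_scale_right g h0 abs_mult flip: right_diff_distrib)
          (simp add: algebra_simps)
      then show "\<bar>state_L2 g h - state_L2 g' h\<bar> \<le> e * (2 * N)"
        using c by simp
    qed
    then show ?thesis
      by simp
  qed
  have zero: "p \<theta> = q \<theta>"
    if "p \<in> per 0" "q \<in> per 0" "\<And>h. h \<in> per k \<Longrightarrow> L2 p h = L2 q h" for p q \<theta>
  proof -
    have "L2 (\<lambda>\<theta>. p \<theta> - q \<theta>) h = 0" if h: "h \<in> per k" for h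
    proof -
      have "h \<in> per 0"
        using per_antimono h by blast
      then show ?thesis
        using L2_lincomb_right[of h p q 1 "-1"] that \<open>p \<in> per 0\<close> \<open>q \<in> per 0\<close>
          \<open>\<And>h. h \<in> per k \<Longrightarrow> L2 p h = L2 q h\<close>[OF h]
        by (simp add: L2_commute[of _ h])
    qed
    then have "p \<theta> - q \<theta> = 0"
      by (rule orthogonal_per_imp_0[OF per_diff[OF that(1,2)]])
    then show ?thesis
      by simp
  qed
  \<comment> \<open>States with one zero component separate the two summands of the pairing.\<close>
  have "L2 (fst g) h = L2 (fst g') h" "L2 (snd g) h = L2 (snd g') h" if "h \<in> per k" for h
    using eq[of "(h, \<lambda>_. 0)"] eq[of "(\<lambda>_. 0, h)"] that
    by (simp_all add: states_iff per_const state_L2_def, simp_all add: L2_def)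
  then show ?thesis
    using zero[of "fst g" "fst g'"] zero[of "snd g" "snd g'"] g
    by (auto simp: states_iff prod_eq_iff fun_eq_iff)
qed

lemma L2_gradient_eqI: "has_L2_gradient k A u g \<Longrightarrow> L2_gradient k A u = g"
  unfolding L2_gradient_def using has_L2_gradient_unique by blast

lemma has_L2_gradient_L2_gradient:
  "L2_differentiable k A u \<Longrightarrow> has_L2_gradient k A u (L2_gradient k A u)"
  unfolding L2_differentiable_def using L2_gradient_eqI by blast

text \<open>An increment h at the translated state is the translate of an increment at u. Norm and
  pairing are both translation invariant, so the same \<delta> works.\<close>

lemma has_L2_gradient_transl:
  assumes inv: "\<And>\<alpha> u. u \<in> states k \<Longrightarrow> A (transl \<alpha> u) = A u" and grad: "has_L2_gradient k A u g"
  shows "has_L2_gradient k A (transl \<alpha> u) (transl \<alpha> g)"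
  unfolding has_L2_gradient_def
proof (intro conjI allI impI)
  note gradD = has_L2_gradientD[OF grad]
  show "transl \<alpha> u \<in> states k" "transl \<alpha> g \<in> states 0"
    using gradD by (auto intro: states_transl)
  fix e :: real
  assume "e > 0"
  then obtain \<delta> where \<delta>: "\<delta> > 0" "\<And>h. h \<in> states k \<Longrightarrow> state_norm k h < \<delta> \<Longrightarrow>
      \<bar>A (u + h) - A u - state_L2 g h\<bar> \<le> e * state_norm k h"
    using gradD(3) by blast
  have "\<bar>A (transl \<alpha> u + h) - A (transl \<alpha> u) - state_L2 (transl \<alpha> g) h\<bar> \<le> e * state_norm k h"
    if h: "h \<in> states k" "state_norm k h < \<delta>" for h
  proof -
    define h' where "h' = transl (- \<alpha>) h"
    have h': "h' \<in> states k" "h' \<in> states 0" "state_norm k h' = state_norm k h" "transl \<alpha> h' = h"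
      using h(1) by (auto simp: h'_def states_transl state_norm_transl transl_transl transl_0
          intro: states_antimono[of 0 k])
    have "A (transl \<alpha> u + h) = A (u + h')" "state_L2 (transl \<alpha> g) h = state_L2 g h'"
      using inv[OF states_add[OF gradD(1) h'(1)], of \<alpha>] state_L2_transl[OF gradD(2) h'(2), of \<alpha>] h'(4)
      by (simp_all add: transl_add)
    with \<delta>(2)[OF h'(1)] h(2) h'(3) inv[OF gradD(1)] show ?thesis
      by simp
  qed
  with \<delta>(1) show "\<exists>\<delta>>0. \<forall>h\<in>states k. state_norm k h < \<delta> \<longrightarrow>
      \<bar>A (transl \<alpha> u + h) - A (transl \<alpha> u) -
        (L2 (fst (transl \<alpha> g)) (fst h) + L2 (snd (transl \<alpha> g)) (snd h))\<bar> \<le> e * state_norm k h"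
    unfolding state_L2_def by blast
qed

lemma L2_gradient_transl:
  assumes "\<And>\<alpha> u. u \<in> states k \<Longrightarrow> A (transl \<alpha> u) = A u" "L2_differentiable k A u"
  shows "L2_gradient k A (transl \<alpha> u) = transl \<alpha> (L2_gradient k A u)"
  using assms by (intro L2_gradient_eqI has_L2_gradient_transl has_L2_gradient_L2_gradient)

text \<open>The forward implication is \<open>has_L2_gradient_transl\<close> for the shift by -
  \<alpha>.\<close>

lemma L2_differentiable_transl_iff:
  assumes "\<And>\<alpha> u. u \<in> states k \<Longrightarrow> A (transl \<alpha> u) = A u"
  shows "L2_differentiable k A (transl \<alpha> u) \<longleftrightarrow> L2_differentiable k A u"
  using has_L2_gradient_transl[of k A, OF assms] transl_transl[of "- \<alpha>" \<alpha> u] transl_0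
  unfolding L2_differentiable_def by (metis add.left_inverse)

text \<open>The increment of the orbit is \<alpha> times q \<alpha>, and A does not change along it;
  so the expansion at u bounds the pairing of g with q \<alpha> by a multiple of e. Since u is
  C^(k+1), q \<alpha> tends to \<open>d_theta u\<close> in the C^k norm, in which the pairing is
  continuous.\<close>

lemma L2_gradient_orthogonal_d_theta:
  assumes inv: "\<And>\<alpha>. A (transl \<alpha> u) = A u"
    and grad: "has_L2_gradient k A u g" and u: "u \<in> states (Suc k)"
  shows "state_L2 g (d_theta u) = 0"
proof -
  define q where "q = (\<lambda>\<alpha>. state_scale (1 / \<alpha>) (transl \<alpha> u - u))"
  define v where "v = d_theta u"
  have uk: "u \<in> states k" and v: "v \<in> states k" and g: "g \<in> states 0"
    using u grad states_d_theta by (auto simp: v_def dest: has_L2_gradientD)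
  have q: "q \<alpha> \<in> states k" for \<alpha>
    unfolding q_def by (intro states_scale states_diff states_transl uk)
  have to_0: "h \<in> states k \<Longrightarrow> h \<in> states 0" for h
    using states_antimono by blast
  have "generates k transl u v"
    using u by (simp add: generates_transl_iff v_def)
  then have lim: "((\<lambda>\<alpha>. state_norm k (q \<alpha> - v)) \<longlongrightarrow> 0) (at 0)"
    by (simp add: generates_def q_def)
  obtain C where C: "C \<ge> 0" "\<And>h. h \<in> states k \<Longrightarrow> \<bar>state_L2 g h\<bar> \<le> C * state_norm k h"
    using state_L2_bound[OF g] by blast
  have "state_L2 g v = 0"
  proof (rule abs_le_all_eps_imp_0)
    fix e :: real
    assume e: "e > 0"
    obtain \<delta> where \<delta>: "\<delta> > 0" "\<And>h. h \<in> states k \<Longrightarrow> state_norm k h < \<delta> \<Longrightarrow>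
        \<bar>A (u + h) - A u - state_L2 g h\<bar> \<le> e * state_norm k h"
      using has_L2_gradientD(3)[OF grad e] by blast
    \<comment> \<open>N bounds the norm of q \<alpha> once q \<alpha> - v has norm below 1; then
      |\<alpha>| < \<delta> / N puts the increment into the ball of radius \<delta>.\<close>
    define N where "N = state_norm k v + 1"
    have N: "N > 0"
      using state_norm_nonneg[OF v] by (simp add: N_def)
    have "\<forall>\<^sub>F \<alpha> in at 0. state_norm k (q \<alpha> - v) < min e 1"
      using e by (intro order_tendstoD(2)[OF lim]) auto
    moreover have "\<forall>\<^sub>F \<alpha> in at (0::real). \<alpha> \<noteq> 0 \<and> \<bar>\<alpha>\<bar> < \<delta> / N"
      using \<delta>(1) N by (auto simp: eventually_at dist_real_def intro!: exI[of _ "\<delta> / N"])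
    ultimately have "\<forall>\<^sub>F \<alpha> in at (0::real). state_norm k (q \<alpha> - v) < min e 1 \<and> \<alpha> \<noteq> 0 \<and> \<bar>\<alpha>\<bar> < \<delta> / N"
      by eventually_elim auto
    then obtain \<alpha> where \<alpha>: "state_norm k (q \<alpha> - v) < min e 1" "\<alpha> \<noteq> 0" "\<bar>\<alpha>\<bar> < \<delta> / N"
      using eventually_happens trivial_limit_at by blast
    have "state_norm k (v + (q \<alpha> - v)) \<le> N"
      using state_norm_triangle[OF v states_diff[OF q v], of \<alpha>] \<alpha>(1) by (simp add: N_def)
    then have qN: "state_norm k (q \<alpha>) \<le> N"
      by simp
    have h: "transl \<alpha> u - u = state_scale \<alpha> (q \<alpha>)"
      using \<alpha>(2) by (simp add: q_def state_scale_def prod_eq_iff fun_eq_iff)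
    have le: "state_norm k (state_scale \<alpha> (q \<alpha>)) \<le> \<bar>\<alpha>\<bar> * N"
      using state_norm_scale_le[OF q, of \<alpha> \<alpha>] qN by (meson abs_ge_zero mult_left_mono order_trans)
    also have "\<dots> < \<delta>"
      using \<alpha>(3) N by (simp add: pos_less_divide_eq)
    finally have "\<bar>A (u + (transl \<alpha> u - u)) - A u - state_L2 g (state_scale \<alpha> (q \<alpha>))\<bar>
        \<le> e * state_norm k (state_scale \<alpha> (q \<alpha>))"
      unfolding h by (intro \<delta>(2) states_scale q)
    also have "\<dots> \<le> e * (\<bar>\<alpha>\<bar> * N)"
      using le e by simp
    finally have "\<bar>\<alpha>\<bar> * \<bar>state_L2 g (q \<alpha>)\<bar> \<le> \<bar>\<alpha>\<bar> * (e * N)"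
      using inv[of \<alpha>] by (simp add: state_L2_scale_right[OF g to_0[OF q]] abs_mult algebra_simps)
    then have "\<bar>state_L2 g (q \<alpha>)\<bar> \<le> e * N"
      using \<alpha>(2) by simp
    moreover have "\<bar>state_L2 g (q \<alpha> - v)\<bar> \<le> C * e"
      using C(2)[OF states_diff[OF q v], of \<alpha>] C(1) \<alpha>(1)
      by (meson less_eq_real_def min_less_iff_conj mult_left_mono order_trans)
    moreover have "state_L2 g (q \<alpha>) = state_L2 g v + state_L2 g (q \<alpha> - v)"
      using state_L2_add_right[OF g to_0[OF v] to_0[OF states_diff[OF q v]], of \<alpha>] by simp
    ultimately show "\<bar>state_L2 g v\<bar> \<le> e * (N + C)"
      by (simp add: algebra_simps)
  qed
  then show ?thesis
    by (simp add: v_def)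
qed


section \<open>The Hamiltonian\<close>

text \<open>Pulling back by this map takes a potential to one for the translated data; domains are
  accordingly written as preimages under it.\<close>

definition plane_translate :: "real \<Rightarrow> real \<times> real \<Rightarrow> real \<times> real" where
  "plane_translate \<alpha> p = (fst p, snd p + \<alpha>)"

lemma continuous_on_plane_translate: "continuous_on A (plane_translate \<alpha>)"
  unfolding plane_translate_def by (intro continuous_intros)

lemma continuous_on_compose_plane_translate:
  "continuous_on D f \<Longrightarrow> continuous_on (plane_translate \<alpha> -` D) (f \<circ> plane_translate \<alpha>)"
  by (intro continuous_on_compose continuous_on_plane_translate)
    (auto intro: continuous_on_subset)

lemma d1_plane_translate: "d1 (\<Phi> \<circ> plane_translate \<alpha>) = d1 \<Phi> \<circ> plane_translate \<alpha>"
  by (simp add: fun_eq_iff d1_def plane_translate_def)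

lemma d2_plane_translate: "d2 (\<Phi> \<circ> plane_translate \<alpha>) = d2 \<Phi> \<circ> plane_translate \<alpha>"
  using deriv_translate[of "\<lambda>t. \<Phi> (r, t)" \<alpha> for r]
  by (simp add: fun_eq_iff d2_def plane_translate_def)

lemma C1_on_plane_translate:
  assumes "C1_on D \<Phi>"
  shows "C1_on (plane_translate \<alpha> -` D) (\<Phi> \<circ> plane_translate \<alpha>)"
proof -
  have "(\<Phi> \<circ> plane_translate \<alpha>) differentiable (at p within plane_translate \<alpha> -` D)"
    if "plane_translate \<alpha> p \<in> D" for p
  proof (rule differentiable_chain_within)
    show "plane_translate \<alpha> differentiable (at p within plane_translate \<alpha> -` D)"
      unfolding plane_translate_def differentiable_def
      by (rule exI) (auto intro!: derivative_eq_intros)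
    show "\<Phi> differentiable (at (plane_translate \<alpha> p) within
        plane_translate \<alpha> ` (plane_translate \<alpha> -` D))"
      using assms that unfolding C1_on_def differentiable_on_def
      by (auto intro: differentiable_within_subset)
  qed
  then show ?thesis
    using assms unfolding C1_on_def d1_plane_translate d2_plane_translate differentiable_on_def
    by (intro conjI ballI continuous_on_compose_plane_translate) auto
qed

lemma harmonic_on_plane_translate:
  "harmonic_on D \<Phi> \<Longrightarrow> harmonic_on (plane_translate \<alpha> -` D) (\<Phi> \<circ> plane_translate \<alpha>)"
  unfolding harmonic_on_def d1_plane_translate d2_plane_translate
  by (auto intro: C1_on_plane_translate)

lemma below_translate: "below (\<lambda>\<theta>. \<xi> (\<theta> + \<alpha>)) = plane_translate \<alpha> -` below \<xi>"
  by (auto simp: below_def plane_translate_def)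

lemma below_closed_translate:
  "below_closed (\<lambda>\<theta>. \<xi> (\<theta> + \<alpha>)) = plane_translate \<alpha> -` below_closed \<xi>"
  by (auto simp: below_closed_def plane_translate_def)

lemma is_potential_translate:
  assumes "is_potential \<xi> \<psi> \<Phi>"
  shows "is_potential (\<lambda>\<theta>. \<xi> (\<theta> + \<alpha>)) (\<lambda>\<theta>. \<psi> (\<theta> + \<alpha>)) (\<Phi> \<circ> plane_translate \<alpha>)"
proof -
  have "\<Phi> (\<rho>, \<theta> + 2 * pi + \<alpha>) = \<Phi> (\<rho>, \<theta> + \<alpha>)" for \<rho> \<theta>
    using assms unfolding is_potential_def by (metis add.assoc add.commute)
  \<comment> \<open>The decay bound holds for all angles at once, hence also at \<theta> +
    \<alpha>.\<close>
  moreover have "uniform_limit UNIV (\<lambda>\<rho> \<theta>. d1 (\<Phi> \<circ> plane_translate \<alpha>) (\<rho>, \<theta>)) (\<lambda>\<theta>. 0) at_bot"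
    unfolding uniform_limit_iff
  proof (intro allI impI)
    fix e :: real
    assume "e > 0"
    then have "\<forall>\<^sub>F \<rho> in at_bot. \<forall>\<theta>\<in>UNIV. dist (d1 \<Phi> (\<rho>, \<theta>)) 0 < e"
      using assms unfolding is_potential_def uniform_limit_iff by blast
    then show "\<forall>\<^sub>F \<rho> in at_bot. \<forall>\<theta>\<in>UNIV. dist (d1 (\<Phi> \<circ> plane_translate \<alpha>) (\<rho>, \<theta>)) 0 < e"
      by eventually_elim (simp add: d1_plane_translate plane_translate_def)
  qed
  ultimately show ?thesis
    using assms unfolding is_potential_def below_translate below_closed_translate
    by (intro conjI harmonic_on_plane_translate continuous_on_compose_plane_translate)
      (auto simp: plane_translate_def)
qed

lemma is_DN_translate:
  assumes "is_DN \<xi> \<psi> g"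
  shows "is_DN (\<lambda>\<theta>. \<xi> (\<theta> + \<alpha>)) (\<lambda>\<theta>. \<psi> (\<theta> + \<alpha>)) (\<lambda>\<theta>. g (\<theta> + \<alpha>))"
proof -
  obtain \<Phi> P Q where *: "is_potential \<xi> \<psi> \<Phi>"
    "continuous_on (below_closed \<xi>) P" "continuous_on (below_closed \<xi>) Q"
    "\<And>p. p \<in> below \<xi> \<Longrightarrow> P p = d1 \<Phi> p \<and> Q p = d2 \<Phi> p"
    "\<And>\<theta>. g \<theta> = P (\<xi> \<theta>, \<theta>) - deriv \<xi> \<theta> * Q (\<xi> \<theta>, \<theta>)"
    using assms unfolding is_DN_def by blast
  show ?thesis
    unfolding is_DN_def
  proof (intro exI conjI ballI allI)
    show "is_potential (\<lambda>\<theta>. \<xi> (\<theta> + \<alpha>)) (\<lambda>\<theta>. \<psi> (\<theta> + \<alpha>)) (\<Phi> \<circ> plane_translate \<alpha>)"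
      by (rule is_potential_translate[OF *(1)])
    show "continuous_on (below_closed (\<lambda>\<theta>. \<xi> (\<theta> + \<alpha>))) (P \<circ> plane_translate \<alpha>)"
      "continuous_on (below_closed (\<lambda>\<theta>. \<xi> (\<theta> + \<alpha>))) (Q \<circ> plane_translate \<alpha>)"
      unfolding below_closed_translate by (intro continuous_on_compose_plane_translate *)+
    show "g (\<theta> + \<alpha>) = (P \<circ> plane_translate \<alpha>) (\<xi> (\<theta> + \<alpha>), \<theta>)
        - deriv (\<lambda>\<theta>. \<xi> (\<theta> + \<alpha>)) \<theta> * (Q \<circ> plane_translate \<alpha>) (\<xi> (\<theta> + \<alpha>), \<theta>)" for \<theta>
      by (simp add: *(5) deriv_translate plane_translate_def)
    fix p
    assume "p \<in> below (\<lambda>\<theta>. \<xi> (\<theta> + \<alpha>))"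
    then show "(P \<circ> plane_translate \<alpha>) p = d1 (\<Phi> \<circ> plane_translate \<alpha>) p"
      "(Q \<circ> plane_translate \<alpha>) p = d2 (\<Phi> \<circ> plane_translate \<alpha>) p"
      using *(4) by (simp_all add: below_translate d1_plane_translate d2_plane_translate)
  qed
qed

text \<open>Translation is invertible, so the candidates for the two sets of data correspond one to
  one; this transports uniqueness as well as existence.\<close>

lemma is_DN_translate_iff:
  "is_DN (\<lambda>\<theta>. \<xi> (\<theta> + \<alpha>)) (\<lambda>\<theta>. \<psi> (\<theta> + \<alpha>)) g \<longleftrightarrow> is_DN \<xi> \<psi> (\<lambda>\<theta>. g (\<theta> - \<alpha>))"
  using is_DN_translate[of "\<lambda>\<theta>. \<xi> (\<theta> + \<alpha>)" "\<lambda>\<theta>. \<psi> (\<theta> + \<alpha>)" g "- \<alpha>"]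
    is_DN_translate[of \<xi> \<psi> "\<lambda>\<theta>. g (\<theta> - \<alpha>)" \<alpha>]
  by auto

lemma DN_eqI:
  assumes "is_DN \<xi> \<psi> g" "\<And>g'. is_DN \<xi> \<psi> g' \<Longrightarrow> g' = g"
  shows "DN \<xi> \<psi> = g"
proof -
  have "\<exists>!g. is_DN \<xi> \<psi> g"
    using assms by blast
  then show ?thesis
    unfolding DN_def using the_equality[of "is_DN \<xi> \<psi>", OF assms] by simp
qed

lemma DN_cases:
  obtains "is_DN \<xi> \<psi> (DN \<xi> \<psi>)" "\<And>g. is_DN \<xi> \<psi> g \<Longrightarrow> g = DN \<xi> \<psi>"
  | "\<nexists>!g. is_DN \<xi> \<psi> g" "DN \<xi> \<psi> = (\<lambda>\<theta>. 0)"
proof (cases "\<exists>!g. is_DN \<xi> \<psi> g")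
  case True
  then obtain g where g: "is_DN \<xi> \<psi> g" "\<And>g'. is_DN \<xi> \<psi> g' \<Longrightarrow> g' = g"
    by blast
  then have DN: "DN \<xi> \<psi> = g"
    by (rule DN_eqI)
  show ?thesis
    using g unfolding DN[symmetric] by (rule that(1))
next
  case False
  then show ?thesis
    by (intro that(2)) (simp_all add: DN_def)
qed

text \<open>Under unique solvability the translated candidate is the only one. Otherwise unique
  solvability also fails for the translated data, and the default value 0 is itself
  invariant.\<close>

lemma DN_translate:
  "DN (\<lambda>\<theta>. \<xi> (\<theta> + \<alpha>)) (\<lambda>\<theta>. \<psi> (\<theta> + \<alpha>)) = (\<lambda>\<theta>. DN \<xi> \<psi> (\<theta> + \<alpha>))"
proof (cases rule: DN_cases[of \<xi> \<psi>])
  case 1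
  show ?thesis
  proof (rule DN_eqI)
    show "is_DN (\<lambda>\<theta>. \<xi> (\<theta> + \<alpha>)) (\<lambda>\<theta>. \<psi> (\<theta> + \<alpha>)) (\<lambda>\<theta>. DN \<xi> \<psi> (\<theta> + \<alpha>))"
      by (rule is_DN_translate[OF 1(1)])
    fix g
    assume "is_DN (\<lambda>\<theta>. \<xi> (\<theta> + \<alpha>)) (\<lambda>\<theta>. \<psi> (\<theta> + \<alpha>)) g"
    then have "(\<lambda>\<theta>. g (\<theta> - \<alpha>)) = DN \<xi> \<psi>"
      using 1(2) is_DN_translate_iff by blast
    then show "g = (\<lambda>\<theta>. DN \<xi> \<psi> (\<theta> + \<alpha>))"
      by (metis add_diff_cancel_right')
  qed
next
  case 2
  have "\<nexists>!g. is_DN (\<lambda>\<theta>. \<xi> (\<theta> + \<alpha>)) (\<lambda>\<theta>. \<psi> (\<theta> + \<alpha>)) g"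
  proof
    assume "\<exists>!g. is_DN (\<lambda>\<theta>. \<xi> (\<theta> + \<alpha>)) (\<lambda>\<theta>. \<psi> (\<theta> + \<alpha>)) g"
    then obtain g where g: "is_DN \<xi> \<psi> (\<lambda>\<theta>. g (\<theta> - \<alpha>))"
      "\<And>g'. is_DN (\<lambda>\<theta>. \<xi> (\<theta> + \<alpha>)) (\<lambda>\<theta>. \<psi> (\<theta> + \<alpha>)) g' \<Longrightarrow> g' = g"
      using is_DN_translate_iff by metis
    have "g' = (\<lambda>\<theta>. g (\<theta> - \<alpha>))" if "is_DN \<xi> \<psi> g'" for g'
      using g(2)[OF is_DN_translate[OF that]] by auto
    with g(1) 2(1) show False
      by blast
  qed
  then show ?thesis
    using 2(2) by (simp add: DN_def)
qed

text \<open>Puts the kinetic energy density into \<open>per 0\<close>, as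
  \<open>integral_translate\<close> requires.\<close>

lemma DN_per_0:
  assumes "\<xi> \<in> per (Suc 0)" "\<psi> \<in> per 0"
  shows "DN \<xi> \<psi> \<in> per 0"
proof (cases rule: DN_cases[of \<xi> \<psi>])
  case 1
  then obtain P Q where *: "continuous_on (below_closed \<xi>) P" "continuous_on (below_closed \<xi>) Q"
    "DN \<xi> \<psi> = (\<lambda>\<theta>. P (\<xi> \<theta>, \<theta>) - deriv \<xi> \<theta> * Q (\<xi> \<theta>, \<theta>))"
    unfolding is_DN_def by blast
  have \<xi>: "continuous_on UNIV \<xi>" "continuous_on UNIV (deriv \<xi>)"
    using assms(1) by (auto dest: per_SucD per_deriv intro: per_0_continuous_on)
  have "continuous_on UNIV (\<lambda>\<theta>. R (\<xi> \<theta>, \<theta>))" if "continuous_on (below_closed \<xi>) R"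
    for R :: "real \<times> real \<Rightarrow> real"
    by (rule continuous_on_compose2[OF that])
      (auto simp: below_closed_def intro!: continuous_intros \<xi>)
  from this[OF *(1)] this[OF *(2)] have "continuous_on UNIV (DN \<xi> \<psi>)"
    unfolding *(3) by (intro continuous_intros \<xi>)
  \<comment> \<open>A shift by 2 pi leaves the data unchanged, so \<open>DN_translate\<close> itself
    yields periodicity.\<close>
  moreover have "DN \<xi> \<psi> (\<theta> + 2 * pi) = DN \<xi> \<psi> \<theta>" for \<theta>
    using DN_translate[of \<xi> "2 * pi" \<psi>] per_periodic[OF assms(1)] per_periodic[OF assms(2)]
    by (simp add: fun_eq_iff)
  ultimately show ?thesis
    by (simp add: per_0_iff)
next
  case 2
  then show ?thesis
    by (simp add: per_const)
qed

lemma hamiltonian_transl: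
  assumes "u \<in> states k" "k \<ge> 1"
  shows "hamiltonian \<sigma> (transl \<alpha> u) = hamiltonian \<sigma> u"
proof -
  obtain \<xi> \<psi> where u: "u = (\<xi>, \<psi>)"
    by fastforce
  have 1: "\<xi> \<in> per (Suc 0)" "\<xi> \<in> per 0" "deriv \<xi> \<in> per 0" "\<psi> \<in> per 0"
    using assms per_antimono[of 1 k] per_antimono[of 0 k] per_deriv[of \<xi> 0]
    by (auto simp: u states_iff)
  have "(\<lambda>\<theta>. \<psi> \<theta> * DN \<xi> \<psi> \<theta>) \<in> per 0"
    "(\<lambda>\<theta>. exp (\<xi> \<theta>) * sqrt (1 + (deriv \<xi> \<theta>)\<^sup>2)) \<in> per 0"
    "(\<lambda>\<theta>. exp (2 * \<xi> \<theta>)) \<in> per 0"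
    by (intro per_0_intros DN_per_0 1)+
  note this[THEN integral_translate, of \<alpha>]
  then show ?thesis
    by (simp add: u hamiltonian_def transl_def DN_translate deriv_translate)
qed


section \<open>The angular momentum\<close>

lemma exp_bounds:
  fixes x :: real
  assumes "\<bar>x\<bar> \<le> 1"
  shows "\<bar>exp x - 1 - x\<bar> \<le> x\<^sup>2" "\<bar>exp x - 1\<bar> \<le> 2 * \<bar>x\<bar>"
proof -
  have "exp x \<le> 1 + x + x\<^sup>2"
  proof (cases "x \<ge> 0")
    case True
    with assms show ?thesis
      by (intro exp_bound) auto
  next
    case False
    \<comment> \<open>The product is 1 - x^3, which is at least 1 for negative x.\<close>
    have "1 \<le> (1 + x + x\<^sup>2) * (1 - x)"
      using False by (simp add: algebra_simps power2_eq_square mult_nonpos_nonneg)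
    also have "\<dots> \<le> (1 + x + x\<^sup>2) * exp (- x)"
      using assms exp_ge_add_one_self[of "- x"] by (intro mult_left_mono) auto
    finally show ?thesis
      by (simp add: exp_minus field_simps)
  qed
  then show *: "\<bar>exp x - 1 - x\<bar> \<le> x\<^sup>2"
    using exp_ge_add_one_self[of x] by linarith
  have "x\<^sup>2 \<le> \<bar>x\<bar>"
    using assms mult_left_mono[of "\<bar>x\<bar>" 1 "\<bar>x\<bar>"] by (simp add: power2_eq_square)
  with * show "\<bar>exp x - 1\<bar> \<le> 2 * \<bar>x\<bar>"
    by linarith
qed

text \<open>Formed as in \<open>ham_field\<close>, the Hamiltonian vector field of this pair is
  \<open>d_theta\<close>: the angular momentum generates the translations.\<close>

definition ang_momentum_gradient :: "state \<Rightarrow> state" where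
  "ang_momentum_gradient u =
     ((\<lambda>\<theta>. - exp (2 * fst u \<theta>) * deriv (snd u) \<theta>), (\<lambda>\<theta>. exp (2 * fst u \<theta>) * deriv (fst u) \<theta>))"

lemma ang_momentum_gradient_states:
  assumes "u \<in> states (Suc 0)"
  shows "ang_momentum_gradient u \<in> states 0"
proof -
  have "fst u \<in> per 0" "deriv (fst u) \<in> per 0" "deriv (snd u) \<in> per 0"
    using assms by (auto simp: states_iff dest: per_SucD per_deriv)
  then show ?thesis
    by (simp add: ang_momentum_gradient_def states_iff per_0_intros)
qed

text \<open>The derivative of e^(2 p) b integrates to 0 over a period. Exponent and factor are
  independent, so that p may be \<xi> + a while b is the increment of \<psi>.\<close>

lemma integral_exp_deriv_by_parts:
  assumes "p \<in> per (Suc 0)" "b \<in> per (Suc 0)"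
  shows "integral {0..2 * pi} (\<lambda>\<theta>. exp (2 * p \<theta>) * deriv b \<theta>) =
    - 2 * integral {0..2 * pi} (\<lambda>\<theta>. exp (2 * p \<theta>) * deriv p \<theta> * b \<theta>)"
proof -
  have 0: "p \<in> per 0" "deriv p \<in> per 0" "b \<in> per 0" "deriv b \<in> per 0"
    using assms by (auto dest: per_SucD per_deriv)
  have "0 = integral {0..2 * pi}
      (\<lambda>\<theta>. 2 * (exp (2 * p \<theta>) * deriv p \<theta> * b \<theta>) + exp (2 * p \<theta>) * deriv b \<theta>)"
    by (rule integral_exact[symmetric, of "\<lambda>\<theta>. exp (2 * p \<theta>) * b \<theta>"])
      (auto intro!: derivative_eq_intros per_has_deriv[OF assms(1)] per_has_deriv[OF assms(2)]
        simp: per_periodic[OF assms(1)] per_periodic[OF assms(2)])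
  also have "\<dots> = 2 * integral {0..2 * pi} (\<lambda>\<theta>. exp (2 * p \<theta>) * deriv p \<theta> * b \<theta>)
      + integral {0..2 * pi} (\<lambda>\<theta>. exp (2 * p \<theta>) * deriv b \<theta>)"
    by (subst integral_add) (auto intro!: per_0_integrable per_0_intros 0)
  finally show ?thesis
    by simp
qed

lemma ang_momentum_eq:
  assumes "(\<xi>, \<psi>) \<in> states (Suc 0)"
  shows "ang_momentum (\<xi>, \<psi>) = integral {0..2 * pi} (\<lambda>\<theta>. exp (2 * \<xi> \<theta>) * deriv \<xi> \<theta> * \<psi> \<theta>)"
  using assms by (simp add: ang_momentum_def states_iff integral_exp_deriv_by_parts)

lemma ang_momentum_transl:
  assumes "u \<in> states (Suc 0)"
  shows "ang_momentum (transl \<alpha> u) = ang_momentum u"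
proof -
  have "fst u \<in> per 0" "deriv (snd u) \<in> per 0"
    using assms by (auto simp: states_iff dest: per_SucD per_deriv)
  then have "(\<lambda>\<theta>. exp (2 * fst u \<theta>) * deriv (snd u) \<theta>) \<in> per 0"
    by (intro per_0_intros)
  from integral_translate[OF this, of \<alpha>] show ?thesis
    by (simp add: ang_momentum_def transl_def deriv_translate case_prod_beta)
qed

text \<open>Only one factor of the quadratic remainder needs the \<open>C\<^sup>1\<close> norm; the other is measured in the sup
  norm, in which solutions of the Hamiltonian system have a time derivative. Integrating
  \<open>e\<^bsup>2(\<xi>+a)\<^esup> b'\<close> by parts removes the derivative from the increment \<open>b\<close> of \<open>\<psi>\<close>.\<close>

lemma ang_momentum_remainder:
  assumes u: "u \<in> states (Suc 0)"
  obtains C where "C \<ge> 0" "\<And>h. h \<in> states (Suc 0) \<Longrightarrow> state_norm (Suc 0) h \<le> 1 / 2 \<Longrightarrow>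
    \<bar>ang_momentum (u + h) - ang_momentum u - state_L2 (ang_momentum_gradient u) h\<bar>
      \<le> C * (state_norm (Suc 0) h * state_norm 0 h)"
proof -
  obtain \<xi> \<psi> where u_eq: "u = (\<xi>, \<psi>)"
    by fastforce
  have 1: "\<xi> \<in> per (Suc 0)" "\<psi> \<in> per (Suc 0)"
    using u by (auto simp: u_eq states_iff)
  have 0: "\<xi> \<in> per 0" "deriv \<xi> \<in> per 0" "\<psi> \<in> per 0" "deriv \<psi> \<in> per 0"
    using 1 by (auto dest: per_SucD per_deriv)
  obtain M where M: "M \<ge> 0" "\<And>\<theta>. exp (2 * \<xi> \<theta>) \<le> M"
    using per_bounded[OF per_0_exp[OF per_cmult[OF 0(1)]], of 2] by auto
  obtain N1 where N1: "N1 \<ge> 0" "\<And>\<theta>. \<bar>deriv \<xi> \<theta>\<bar> \<le> N1"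
    using per_bounded[OF 0(2)] by blast
  obtain N2 where N2: "N2 \<ge> 0" "\<And>\<theta>. \<bar>deriv \<psi> \<theta>\<bar> \<le> N2"
    using per_bounded[OF 0(4)] by blast
  \<comment> \<open>M bounds the common factor e^(2 \<xi>). The Taylor remainder gives 2 N2, half of
    4 times N2; the other term gives 4 (N1 + 1) + 1. The length of the period is added at the
    end.\<close>
  define C where "C = M * (2 * N2 + 4 * N1 + 5)"
  have "\<bar>ang_momentum (u + h) - ang_momentum u - state_L2 (ang_momentum_gradient u) h\<bar>
      \<le> 2 * pi * (C * (state_norm (Suc 0) h * state_norm 0 h))"
    if h: "h \<in> states (Suc 0)" "state_norm (Suc 0) h \<le> 1 / 2" for h
  proof -
    obtain a b where h_eq: "h = (a, b)"
      by fastforce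
    define n0 n1 where "n0 = state_norm 0 h" and "n1 = state_norm (Suc 0) h"
    have a1: "a \<in> per (Suc 0)" "b \<in> per (Suc 0)"
      using h by (auto simp: h_eq states_iff)
    have a0: "a \<in> per 0" "deriv a \<in> per 0" "b \<in> per 0" "deriv b \<in> per 0"
      using a1 by (auto dest: per_SucD per_deriv)
    have h0: "h \<in> states 0"
      using a0 by (simp add: h_eq states_iff)
    have le: "\<bar>a \<theta>\<bar> \<le> n0" "\<bar>b \<theta>\<bar> \<le> n0" "\<bar>a \<theta>\<bar> \<le> n1" "\<bar>deriv a \<theta>\<bar> \<le> n1" for \<theta>
      using state_norm_ge_abs[OF h0, of \<theta>] state_norm_ge_abs[OF h(1), of \<theta>]
        state_norm_ge[OF h(1), of "Suc 0" \<theta>]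
      by (simp_all add: h_eq n0_def n1_def)
    have n: "n0 \<ge> 0" "n1 \<ge> 0" "n1 \<le> 1 / 2"
      using state_norm_nonneg h h0 by (auto simp: n0_def n1_def)
    define p where "p = (\<lambda>\<theta>. \<xi> \<theta> + a \<theta>)"
    have deriv_sum: "deriv (\<lambda>\<theta>. f \<theta> + g \<theta>) = (\<lambda>\<theta>. deriv f \<theta> + deriv g \<theta>)"
      if "f \<in> per (Suc 0)" "g \<in> per (Suc 0)" for f g
      using deriv_lincomb[OF that, of 1 1] by simp
    have p: "p \<in> per (Suc 0)" "p \<in> per 0" "deriv p = (\<lambda>\<theta>. deriv \<xi> \<theta> + deriv a \<theta>)"
      unfolding p_def by (intro per_add 1 a1 0 a0 deriv_sum)+
    have dp: "deriv p \<in> per 0"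
      by (intro per_deriv p)
    \<comment> \<open>The integrand of the whole remainder after integration by parts: b' no longer
      occurs, so the increment of \<psi> enters only through its sup norm.\<close>
    define R where "R = (\<lambda>\<theta>. - 1 / 2 * (exp (2 * p \<theta>) * deriv \<psi> \<theta>) + exp (2 * p \<theta>) * deriv p \<theta> * b \<theta>
        - (- 1 / 2 * (exp (2 * \<xi> \<theta>) * deriv \<psi> \<theta>))
        - (- exp (2 * \<xi> \<theta>) * deriv \<psi> \<theta> * a \<theta> + exp (2 * \<xi> \<theta>) * deriv \<xi> \<theta> * b \<theta>))"
    have "ang_momentum (u + h) =
        - 1 / 2 * integral {0..2 * pi} (\<lambda>\<theta>. exp (2 * p \<theta>) * deriv \<psi> \<theta> + exp (2 * p \<theta>) * deriv b \<theta>)"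
      using deriv_sum[OF 1(2) a1(2)]
      by (simp add: ang_momentum_def u_eq h_eq plus_fun_def p_def algebra_simps)
    also have "\<dots> = - 1 / 2 * integral {0..2 * pi} (\<lambda>\<theta>. exp (2 * p \<theta>) * deriv \<psi> \<theta>)
        + integral {0..2 * pi} (\<lambda>\<theta>. exp (2 * p \<theta>) * deriv p \<theta> * b \<theta>)"
    proof -
      have "integral {0..2 * pi} (\<lambda>\<theta>. exp (2 * p \<theta>) * deriv \<psi> \<theta> + exp (2 * p \<theta>) * deriv b \<theta>) =
          integral {0..2 * pi} (\<lambda>\<theta>. exp (2 * p \<theta>) * deriv \<psi> \<theta>)
          + integral {0..2 * pi} (\<lambda>\<theta>. exp (2 * p \<theta>) * deriv b \<theta>)"
        by (intro integral_add per_0_integrable per_0_intros p 0 a0)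
      then show ?thesis
        unfolding integral_exp_deriv_by_parts[OF p(1) a1(2)] by linarith
    qed
    finally have ang: "ang_momentum (u + h) = \<dots>" .
    have "(R has_integral
        (- 1 / 2 * integral {0..2 * pi} (\<lambda>\<theta>. exp (2 * p \<theta>) * deriv \<psi> \<theta>)
          + integral {0..2 * pi} (\<lambda>\<theta>. exp (2 * p \<theta>) * deriv p \<theta> * b \<theta>))
        - (- 1 / 2 * integral {0..2 * pi} (\<lambda>\<theta>. exp (2 * \<xi> \<theta>) * deriv \<psi> \<theta>))
        - (integral {0..2 * pi} (\<lambda>\<theta>. - exp (2 * \<xi> \<theta>) * deriv \<psi> \<theta> * a \<theta>)
          + integral {0..2 * pi} (\<lambda>\<theta>. exp (2 * \<xi> \<theta>) * deriv \<xi> \<theta> * b \<theta>))) {0..2 * pi}"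
      unfolding R_def
      by (intro has_integral_add has_integral_diff has_integral_mult_right integrable_integral
          per_0_integrable per_0_intros p dp 0 a0)
    then have "ang_momentum (u + h) - ang_momentum u - state_L2 (ang_momentum_gradient u) h =
        integral {0..2 * pi} R"
      unfolding ang by (simp add: integral_unique u_eq h_eq ang_momentum_def state_L2_def
          ang_momentum_gradient_def L2_def)
    moreover have "R \<in> per 0"
      unfolding R_def by (intro per_0_intros p dp 0 a0)
    moreover have "\<bar>R \<theta>\<bar> \<le> C * (n1 * n0)" for \<theta>
    proof -
      let ?E = "exp (2 * \<xi> \<theta>)" and ?X = "exp (2 * a \<theta>)"
      have X: "\<bar>?X - 1 - 2 * a \<theta>\<bar> \<le> 4 * (n1 * n0)" "\<bar>?X - 1\<bar> \<le> 4 * n0" "\<bar>?X - 1\<bar> \<le> 4 * n1"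
      proof -
        \<comment> \<open>The radius 1 / 2 is chosen for this, since the exponent is 2 a and
          \<open>exp_bounds\<close> needs arguments in [-1, 1].\<close>
        have "\<bar>2 * a \<theta>\<bar> \<le> 1"
          using le(3)[of \<theta>] n by simp
        note bds = exp_bounds[OF this]
        have "(a \<theta>)\<^sup>2 \<le> n1 * n0"
          using mult_mono[OF le(3)[of \<theta>] le(1)[of \<theta>]] n by (simp add: power2_eq_square flip: abs_mult)
        with bds le(1,3)[of \<theta>] show "\<bar>?X - 1 - 2 * a \<theta>\<bar> \<le> 4 * (n1 * n0)"
          "\<bar>?X - 1\<bar> \<le> 4 * n0" "\<bar>?X - 1\<bar> \<le> 4 * n1"
          by (auto simp: power_mult_distrib)
      qed
      \<comment> \<open>Every summand is now of second order: a^2 is split as n1 n0, and elsewhere b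
        supplies n0 while X - 1 or a' supplies n1.\<close>
      have "R \<theta> = ?E * (- 1 / 2 * (deriv \<psi> \<theta> * (?X - 1 - 2 * a \<theta>))
          + ((?X - 1) * (deriv \<xi> \<theta> + deriv a \<theta>) + deriv a \<theta>) * b \<theta>)"
        unfolding R_def p(3) by (simp add: p_def distrib_left exp_add algebra_simps)
      also have "\<bar>\<dots>\<bar> \<le> M * ((2 * N2 + 4 * N1 + 5) * (n1 * n0))"
      proof -
        have 1: "\<bar>deriv \<psi> \<theta> * (?X - 1 - 2 * a \<theta>)\<bar> \<le> N2 * (4 * (n1 * n0))"
          unfolding abs_mult using N2 X by (intro mult_mono) auto
        have "\<bar>deriv \<xi> \<theta> + deriv a \<theta>\<bar> \<le> N1 + 1"
          using N1(2)[of \<theta>] le(4)[of \<theta>] n by linarith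
        then have "\<bar>(?X - 1) * (deriv \<xi> \<theta> + deriv a \<theta>)\<bar> \<le> 4 * n1 * (N1 + 1)"
          unfolding abs_mult using X n by (intro mult_mono) auto
        then have "\<bar>(?X - 1) * (deriv \<xi> \<theta> + deriv a \<theta>) + deriv a \<theta>\<bar> \<le> (4 * N1 + 5) * n1"
          using le(4)[of \<theta>] by (simp add: algebra_simps)
        then have 2: "\<bar>((?X - 1) * (deriv \<xi> \<theta> + deriv a \<theta>) + deriv a \<theta>) * b \<theta>\<bar> \<le> (4 * N1 + 5) * n1 * n0"
          unfolding abs_mult using le(2)[of \<theta>] n N1 by (intro mult_mono) auto
        have "\<bar>- 1 / 2 * (deriv \<psi> \<theta> * (?X - 1 - 2 * a \<theta>))
          + ((?X - 1) * (deriv \<xi> \<theta> + deriv a \<theta>) + deriv a \<theta>) * b \<theta>\<bar> \<le>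
            1 / 2 * (N2 * (4 * (n1 * n0))) + (4 * N1 + 5) * n1 * n0"
          using 1 2 by linarith
        also have "\<dots> = (2 * N2 + 4 * N1 + 5) * (n1 * n0)"
          by (simp add: algebra_simps)
        finally show ?thesis
          unfolding abs_mult[of ?E] using M by (intro mult_mono) auto
      qed
      finally show ?thesis
        by (simp add: C_def mult.assoc)
    qed
    ultimately show ?thesis
      using integral_period_bound[of R "C * (n1 * n0)"] by (simp add: n0_def n1_def)
  qed
  moreover have "C \<ge> 0"
    using M N1 N2 by (simp add: C_def)
  ultimately show thesis
    by (intro that[of "2 * pi * C"]) (auto simp: mult.assoc)
qed

lemma has_L2_gradient_ang_momentum:
  assumes u: "u \<in> states k" and k: "k \<ge> 1"
  shows "has_L2_gradient k ang_momentum u (ang_momentum_gradient u)"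
  unfolding has_L2_gradient_def state_L2_def[symmetric]
proof (intro conjI allI impI)
  have u1: "u \<in> states (Suc 0)"
    using states_antimono[OF _ u, of "Suc 0"] k by simp
  show "u \<in> states k" "ang_momentum_gradient u \<in> states 0"
    using u u1 by (auto intro: ang_momentum_gradient_states)
  obtain C where C: "C \<ge> 0" "\<And>h. h \<in> states (Suc 0) \<Longrightarrow> state_norm (Suc 0) h \<le> 1 / 2 \<Longrightarrow>
    \<bar>ang_momentum (u + h) - ang_momentum u - state_L2 (ang_momentum_gradient u) h\<bar>
      \<le> C * (state_norm (Suc 0) h * state_norm 0 h)"
    using ang_momentum_remainder[OF u1] by blast
  fix e :: real
  assume e: "e > 0"
  \<comment> \<open>The first radius is that of the remainder estimate; in the second, C + 1 is
    positive even if C = 0.\<close>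
  have "\<bar>ang_momentum (u + h) - ang_momentum u - state_L2 (ang_momentum_gradient u) h\<bar>
      \<le> e * state_norm k h"
    if h: "h \<in> states k" "state_norm k h < min (1 / 2) (e / (C + 1))" for h
  proof -
    have h1: "h \<in> states (Suc 0)" "h \<in> states 0"
      using states_antimono[OF _ h(1)] k by auto
    have le: "state_norm (Suc 0) h \<le> state_norm k h" "state_norm 0 h \<le> state_norm k h"
      using state_norm_mono[OF _ h(1)] k by auto
    note nonneg = state_norm_nonneg[OF h(1)] state_norm_nonneg[OF h1(2)]
    have "C * (state_norm (Suc 0) h * state_norm 0 h) \<le> C * (state_norm k h * state_norm k h)"
      using C le nonneg by (intro mult_left_mono mult_mono) auto
    also have "\<dots> \<le> (C + 1) * state_norm k h * state_norm k h"
      using nonneg by (simp add: algebra_simps)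
    also have "\<dots> \<le> e * state_norm k h"
      using h(2) C nonneg by (intro mult_right_mono) (auto simp: field_simps)
    finally show ?thesis
      using C(2)[OF h1(1)] h(2) le(1) by linarith
  qed
  then show "\<exists>\<delta>>0. \<forall>h\<in>states k. state_norm k h < \<delta> \<longrightarrow>
      \<bar>ang_momentum (u + h) - ang_momentum u - state_L2 (ang_momentum_gradient u) h\<bar>
        \<le> e * state_norm k h"
    using e C(1) by (intro exI[of _ "min (1 / 2) (e / (C + 1))"]) auto
qed

lemmas L2_gradient_ang_momentum = L2_gradient_eqI[OF has_L2_gradient_ang_momentum]

section \<open>The bracket with the angular momentum and conservation along the flow\<close>

lemma state_L2_ang_momentum_gradient_ham_field:
  "state_L2 (ang_momentum_gradient u) (ham_field k A u) = - state_L2 (L2_gradient k A u) (d_theta u)"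
  by (simp add: state_L2_def ang_momentum_gradient_def ham_field_def d_theta_def L2_def
      exp_minus algebra_simps)

lemma bracket_ang_momentum:
  assumes "u \<in> states k" "k \<ge> 1"
  shows "bracket k ang_momentum A u = - state_L2 (L2_gradient k A u) (d_theta u)"
  by (simp add: bracket_def L2_gradient_ang_momentum[OF assms] ang_momentum_gradient_def
      state_L2_def d_theta_def L2_def exp_minus algebra_simps)

text \<open>Gradients are by definition only pairs of continuous functions, so the field is placed
  in C^0, the space in which solutions have their time derivative.\<close>

lemma ham_field_states:
  assumes "L2_differentiable k A u"
  shows "ham_field k A u \<in> states 0"
proof -
  have "fst u \<in> per k" "fst (L2_gradient k A u) \<in> per 0" "snd (L2_gradient k A u) \<in> per 0"
    using has_L2_gradientD(1,2)[OF has_L2_gradient_L2_gradient[OF assms]] by (auto simp: states_iff)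
  then show ?thesis
    using per_antimono[of 0 k "fst u"] by (simp add: ham_field_def states_iff per_0_intros)
qed

text \<open>Divided by s - t, the remainder is at most C times the C^k norm of the increment, which
  tends to 0, times the sup norm of the difference quotient, which stays bounded. So the time
  derivative is the pairing of the gradient with the field, which vanishes.\<close>

lemma ang_momentum_conserved:
  assumes inv: "\<And>\<alpha> u. u \<in> states k \<Longrightarrow> A (transl \<alpha> u) = A u" and k: "k \<ge> 1"
    and J: "is_interval J" and sol: "ham_solution k A J u" and s: "s \<in> J" "t \<in> J"
  shows "ang_momentum (u s) = ang_momentum (u t)"
proof -
  have "((\<lambda>s. ang_momentum (u s)) has_real_derivative 0) (at t within J)" if t: "t \<in> J" for t
  proof -
    define X where "X = ham_field k A (u t)"
    define h where "h = (\<lambda>s. u s - u t)"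
    define D where "D = (\<lambda>s. state_scale (1 / (s - t)) (h s))"
    define G where "G = ang_momentum_gradient (u t)"
    have ut: "u s \<in> states (Suc k)" if "s \<in> J" for s
      using sol that by (simp add: ham_solution_def)
    have diff: "L2_differentiable k A (u t)"
      and lim_h: "((\<lambda>s. state_norm k (h s)) \<longlongrightarrow> 0) (at t within J)"
      and lim_D: "((\<lambda>s. state_norm 0 (D s - X)) \<longlongrightarrow> 0) (at t within J)"
      using sol t by (auto simp: ham_solution_def X_def h_def D_def)
    have u1: "u t \<in> states (Suc 0)" and utk: "u t \<in> states k"
      using states_antimono[OF _ ut[OF t]] k by auto
    have X: "X \<in> states 0"
      unfolding X_def by (rule ham_field_states[OF diff])
    have G: "G \<in> states 0"
      unfolding G_def by (rule ang_momentum_gradient_states[OF u1])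
    \<comment> \<open>Up to sign this is the pairing of the gradient of A with
      \<open>d_theta (u t)\<close>, zero by invariance of A; it applies because solutions take
      C^(k+1) values.\<close>
    have GX: "state_L2 G X = 0"
      unfolding G_def X_def state_L2_ang_momentum_gradient_ham_field
      using L2_gradient_orthogonal_d_theta[OF inv[OF utk] has_L2_gradient_L2_gradient[OF diff] ut[OF t]]
      by simp
    have hk: "h s \<in> states k" if "s \<in> J" for s
      unfolding h_def using that t ut by (intro states_diff) (auto intro: states_antimono[of k "Suc k"])
    obtain K where K: "K \<ge> 0" "\<And>h. h \<in> states 0 \<Longrightarrow> \<bar>state_L2 G h\<bar> \<le> K * state_norm 0 h"
      using state_L2_bound[OF G] by blast
    obtain C where C: "C \<ge> 0" "\<And>h. h \<in> states (Suc 0) \<Longrightarrow> state_norm (Suc 0) h \<le> 1 / 2 \<Longrightarrow>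
      \<bar>ang_momentum (u t + h) - ang_momentum (u t) - state_L2 G h\<bar>
        \<le> C * (state_norm (Suc 0) h * state_norm 0 h)"
      using ang_momentum_remainder[OF u1] unfolding G_def by blast
    \<comment> \<open>The first term is the error of the difference quotient paired with G; the
      second is the remainder, with the sup norm of D s estimated through X.\<close>
    let ?b = "\<lambda>s. K * state_norm 0 (D s - X)
      + C * (state_norm k (h s) * (state_norm 0 X + state_norm 0 (D s - X)))"
    have "\<forall>\<^sub>F s in at t within J. s \<in> J \<and> s \<noteq> t"
      by (simp add: eventually_at_filter)
    moreover have "\<forall>\<^sub>F s in at t within J. state_norm k (h s) < 1 / 2"
      by (rule order_tendstoD(2)[OF lim_h]) simp
    ultimately have "\<forall>\<^sub>F s in at t within J.
        norm ((ang_momentum (u s) - ang_momentum (u t)) / (s - t)) \<le> ?b s"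
    proof eventually_elim
      case (elim s)
      have hs: "h s \<in> states k" "h s \<in> states (Suc 0)" "h s \<in> states 0"
        using hk[of s] elim k states_antimono[of "Suc 0" k "h s"] states_antimono[of 0 k "h s"]
        by simp_all
      have Ds: "D s \<in> states 0" "D s - X \<in> states 0"
        unfolding D_def using hs X by (auto intro!: states_scale states_diff)
      have h_eq: "h s = state_scale (s - t) (D s)"
        using elim by (simp add: D_def state_scale_def prod_eq_iff fun_eq_iff)
      have D_le: "state_norm 0 (D s) \<le> state_norm 0 X + state_norm 0 (D s - X)"
        using state_norm_triangle[OF X Ds(2)] by simp
      have "state_norm 0 (h s) \<le> \<bar>s - t\<bar> * state_norm 0 (D s)"
        using state_norm_scale_le[OF Ds(1), of "s - t"] by (simp flip: h_eq)
      also have "\<dots> \<le> \<bar>s - t\<bar> * (state_norm 0 X + state_norm 0 (D s - X))"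
        using D_le by (intro mult_left_mono) auto
      finally have h0: "state_norm 0 (h s) \<le> \<bar>s - t\<bar> * (state_norm 0 X + state_norm 0 (D s - X))" .
      have h1: "state_norm (Suc 0) (h s) \<le> state_norm k (h s)"
        using state_norm_mono[OF _ hs(1)] k by simp
      have us: "u s = u t + h s"
        by (simp add: h_def)
      have "\<bar>ang_momentum (u s) - ang_momentum (u t) - state_L2 G (h s)\<bar>
          \<le> C * (state_norm (Suc 0) (h s) * state_norm 0 (h s))"
        unfolding us using elim h1 by (intro C(2) hs) auto
      also have "\<dots> \<le> C * (state_norm k (h s) * (\<bar>s - t\<bar> * (state_norm 0 X + state_norm 0 (D s - X))))"
        using h0 h1 C(1) hs by (intro mult_left_mono mult_mono state_norm_nonneg)
      finally have rem: "\<bar>ang_momentum (u s) - ang_momentum (u t) - state_L2 G (h s)\<bar> \<le>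
          \<bar>s - t\<bar> * (C * (state_norm k (h s) * (state_norm 0 X + state_norm 0 (D s - X))))"
        by (simp add: algebra_simps)
      \<comment> \<open>The main part X of the difference quotient drops out by \<open>GX\<close>,
        leaving only its error.\<close>
      have "state_L2 G (D s) = state_L2 G (D s - X)"
        using state_L2_add_right[OF G X Ds(2)] GX by simp
      then have "\<bar>state_L2 G (h s)\<bar> \<le> \<bar>s - t\<bar> * (K * state_norm 0 (D s - X))"
        using K(2)[OF Ds(2)] by (simp add: h_eq state_L2_scale_right[OF G Ds(1)] abs_mult mult_left_mono)
      with rem have "\<bar>ang_momentum (u s) - ang_momentum (u t)\<bar> \<le> \<bar>s - t\<bar> * ?b s"
        unfolding distrib_left by linarith
      with elim show ?case
        by (simp add: abs_divide pos_divide_le_eq mult.commute)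
    qed
    moreover have "(?b \<longlongrightarrow> K * 0 + C * (0 * (state_norm 0 X + 0))) (at t within J)"
      by (intro tendsto_intros lim_h lim_D)
    then have "(?b \<longlongrightarrow> 0) (at t within J)"
      by simp
    ultimately have "((\<lambda>s. (ang_momentum (u s) - ang_momentum (u t)) / (s - t)) \<longlongrightarrow> 0) (at t within J)"
      by (rule Lim_null_comparison)
    then show ?thesis
      by (simp add: has_field_derivative_iff)
  qed
  then obtain c where "\<forall>x\<in>J. ang_momentum (u x) = c"
    using has_field_derivative_zero_constant[of J "\<lambda>s. ang_momentum (u s)"] J is_interval_convex by blast
  with s show ?thesis
    by simp
qed


theorem lemma3p5:
  fixes \<sigma>\<^sub>0 :: real and k :: nat
  assumes "k \<ge> 2"
  shows
    \<comment> \<open>one-parameter group of the circle\<close>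
    "(\<forall>u\<in>states k. transl 0 u = u \<and>
        (\<forall>\<alpha> \<beta>. transl \<alpha> u \<in> states k \<and> transl (\<alpha> + \<beta>) u = transl \<alpha> (transl \<beta> u) \<and>
               transl (\<alpha> + 2 * pi) u = transl \<alpha> u)) \<and>
     \<comment> \<open>(i)\<close>
     (\<forall>u v. generates k transl u v \<longleftrightarrow> u \<in> states (Suc k) \<and> v = d_theta u) \<and>
     (\<forall>\<alpha>. \<forall>u\<in>states (Suc k). transl \<alpha> (d_theta u) = d_theta (transl \<alpha> u)) \<and>
     \<comment> \<open>(ii)\<close>
     (\<forall>\<alpha>. \<forall>u\<in>states k. hamiltonian \<sigma>\<^sub>0 (transl \<alpha> u) = hamiltonian \<sigma>\<^sub>0 u) \<and>
     (\<forall>\<alpha>. \<forall>u\<in>states k.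
        (L2_differentiable k (hamiltonian \<sigma>\<^sub>0) (transl \<alpha> u) \<longleftrightarrow>
           L2_differentiable k (hamiltonian \<sigma>\<^sub>0) u) \<and>
        (L2_differentiable k (hamiltonian \<sigma>\<^sub>0) u \<longrightarrow>
           L2_gradient k (hamiltonian \<sigma>\<^sub>0) (transl \<alpha> u) =
             transl \<alpha> (L2_gradient k (hamiltonian \<sigma>\<^sub>0) u))) \<and>
     \<comment> \<open>(iii)\<close>
     (\<forall>\<xi> \<psi>. (\<xi>, \<psi>) \<in> states k \<longrightarrow>
        ang_momentum (\<xi>, \<psi>) =
          integral {0..2 * pi} (\<lambda>\<theta>. exp (2 * \<xi> \<theta>) * deriv \<xi> \<theta> * \<psi> \<theta>) \<and>
        has_L2_gradient k ang_momentum (\<xi>, \<psi>)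
          ((\<lambda>\<theta>. - exp (2 * \<xi> \<theta>) * deriv \<psi> \<theta>), (\<lambda>\<theta>. exp (2 * \<xi> \<theta>) * deriv \<xi> \<theta>)) \<and>
        L2_gradient k ang_momentum (\<xi>, \<psi>) =
          ((\<lambda>\<theta>. - exp (2 * \<xi> \<theta>) * deriv \<psi> \<theta>), (\<lambda>\<theta>. exp (2 * \<xi> \<theta>) * deriv \<xi> \<theta>))) \<and>
     (\<forall>u\<in>states (Suc k). L2_differentiable k (hamiltonian \<sigma>\<^sub>0) u \<longrightarrow>
        bracket k ang_momentum (hamiltonian \<sigma>\<^sub>0) u = 0) \<and>
     (\<forall>J u. is_interval J \<and> ham_solution k (hamiltonian \<sigma>\<^sub>0) J u \<longrightarrow>
        (\<forall>s\<in>J. \<forall>t\<in>J. ang_momentum (u s) = ang_momentum (u t))) \<and>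
     (\<forall>\<alpha>. \<forall>u\<in>states k. ang_momentum (transl \<alpha> u) = ang_momentum u) \<and>
     (\<forall>\<alpha>. \<forall>u\<in>states k.
        L2_gradient k ang_momentum (transl \<alpha> u) = transl \<alpha> (L2_gradient k ang_momentum u))"
proof -
  have inv_H: "\<And>\<alpha> u. u \<in> states k \<Longrightarrow> hamiltonian \<sigma>\<^sub>0 (transl \<alpha> u) = hamiltonian \<sigma>\<^sub>0 u"
    using hamiltonian_transl assms by simp
  have inv_I: "\<And>\<alpha> u. u \<in> states k \<Longrightarrow> ang_momentum (transl \<alpha> u) = ang_momentum u"
    using ang_momentum_transl states_antimono[of "Suc 0" k] assms by simp
  have grad_I: "has_L2_gradient k ang_momentum u (ang_momentum_gradient u)" if "u \<in> states k" for u
    using has_L2_gradient_ang_momentum[OF that] assms by simp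
  have bracket_0: "bracket k ang_momentum (hamiltonian \<sigma>\<^sub>0) u = 0"
    if "u \<in> states (Suc k)" "L2_differentiable k (hamiltonian \<sigma>\<^sub>0) u" for u
  proof -
    have u: "u \<in> states k"
      using states_antimono[OF _ that(1)] by simp
    show ?thesis
      using bracket_ang_momentum[OF u] assms
        L2_gradient_orthogonal_d_theta[OF inv_H[OF u] has_L2_gradient_L2_gradient[OF that(2)] that(1)]
      by simp
  qed
  show ?thesis
  proof (intro conjI ballI allI impI)
    fix u :: state and \<alpha> \<beta> :: real
    assume u: "u \<in> states k"
    show "transl 0 u = u" "transl \<alpha> u \<in> states k" "transl (\<alpha> + \<beta>) u = transl \<alpha> (transl \<beta> u)"
      "transl (\<alpha> + 2 * pi) u = transl \<alpha> u"
      using u by (simp_all add: transl_0 states_transl transl_transl transl_period)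
    show "hamiltonian \<sigma>\<^sub>0 (transl \<alpha> u) = hamiltonian \<sigma>\<^sub>0 u"
      "ang_momentum (transl \<alpha> u) = ang_momentum u"
      by (rule inv_H[OF u] inv_I[OF u])+
    show "L2_differentiable k (hamiltonian \<sigma>\<^sub>0) (transl \<alpha> u) \<longleftrightarrow>
        L2_differentiable k (hamiltonian \<sigma>\<^sub>0) u"
      by (rule L2_differentiable_transl_iff[OF inv_H])
    show "L2_gradient k (hamiltonian \<sigma>\<^sub>0) (transl \<alpha> u) = transl \<alpha> (L2_gradient k (hamiltonian \<sigma>\<^sub>0) u)"
      if "L2_differentiable k (hamiltonian \<sigma>\<^sub>0) u"
      by (rule L2_gradient_transl[OF inv_H that])
    show "L2_gradient k ang_momentum (transl \<alpha> u) = transl \<alpha> (L2_gradient k ang_momentum u)"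
    proof (rule L2_gradient_transl[OF inv_I])
      show "L2_differentiable k ang_momentum u"
        using grad_I[OF u] unfolding L2_differentiable_def by (rule exI)
    qed
  next
    fix \<xi> \<psi>
    assume u: "(\<xi>, \<psi>) \<in> states k"
    show "ang_momentum (\<xi>, \<psi>) =
        integral {0..2 * pi} (\<lambda>\<theta>. exp (2 * \<xi> \<theta>) * deriv \<xi> \<theta> * \<psi> \<theta>)"
      using ang_momentum_eq states_antimono[OF _ u, of "Suc 0"] assms by simp
    show "has_L2_gradient k ang_momentum (\<xi>, \<psi>)
        ((\<lambda>\<theta>. - exp (2 * \<xi> \<theta>) * deriv \<psi> \<theta>), (\<lambda>\<theta>. exp (2 * \<xi> \<theta>) * deriv \<xi> \<theta>))"
      using grad_I[OF u] by (simp add: ang_momentum_gradient_def)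
    then show "L2_gradient k ang_momentum (\<xi>, \<psi>) =
        ((\<lambda>\<theta>. - exp (2 * \<xi> \<theta>) * deriv \<psi> \<theta>), (\<lambda>\<theta>. exp (2 * \<xi> \<theta>) * deriv \<xi> \<theta>))"
      by (rule L2_gradient_eqI)
  next
    fix J u s t
    assume sol: "is_interval J \<and> ham_solution k (hamiltonian \<sigma>\<^sub>0) J u" and J: "s \<in> J" "t \<in> J"
    show "ang_momentum (u s) = ang_momentum (u t)"
    proof (rule ang_momentum_conserved[OF inv_H _ conjunct1[OF sol] conjunct2[OF sol] J])
      show "1 \<le> k"
        using assms by simp
    qed
  next
    fix u v :: state and \<alpha> :: real
    show "generates k transl u v \<longleftrightarrow> u \<in> states (Suc k) \<and> v = d_theta u"
      by (rule generates_transl_iff)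
    show "transl \<alpha> (d_theta u) = d_theta (transl \<alpha> u)"
      by (rule transl_d_theta)
    show "bracket k ang_momentum (hamiltonian \<sigma>\<^sub>0) u = 0"
      if "u \<in> states (Suc k)" "L2_differentiable k (hamiltonian \<sigma>\<^sub>0) u"
      using that by (rule bracket_0)
  qed
qed

end
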